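(* Let $k\in\mathbb N$, let $s\ge2$ be real, and suppose that $\Delta_s$ is an admissible exponent for $k$. Then for every $\varepsilon>0$ there exists $\eta>0$ such that, for all sufficiently large $P$, all $R$ with $2\le R\le P^\eta$ and all real $Q$ with $1\le Q\le P^{k/2}$, one has \[ \int_{\mathfrak M(Q,P)}|f(\alpha;P,R)|^s\,d\alpha\ll P^{s-k+\varepsilon}Q^{2\Delta_s/k}, \] with implied constant depending only on $\varepsilon,\eta,k,s$.
   Context: For real $P,R\ge1$, $\mathscr A(P,R)$ is the set of integers $n\in[1,P]$ all of whose prime divisors are at most $R$; $e(z)=e^{2\pi iz}$; $f(\alpha;P,R)=\sum_{x\in\mathscr A(P,R)}e(\alpha x^k)$; $U_s(P,R)=\int_0^1|f(\alpha;P,R)|^s\,d\alpha$. A real $\Delta_s$ is an admissible exponent (for $k$) if for every $\varepsilon>0$ there is $\eta>0$ (depending on $\varepsilon,k,s$) such that for $P$ sufficiently large and $1\le R\le P^\eta$ one has $U_s(P,R)\le C P^{s-k+\Delta_s+\varepsilon}$ with $C=C(\varepsilon,\eta,k,s)$. For $1\le Q\le P^{k/2}$, $\mathfrak M(Q,P)$ is the union over integers $1\le q\le Q$, $0\le a\le q$, $(a,q)=1$ of the sets $\{\alpha\in[0,1):|q\alpha-a|\le QP^{-k}\}$. *)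

theory Defs
  imports "HOL-Analysis.Analysis"
begin

definition smooth_set :: "real \<Rightarrow> real \<Rightarrow> nat set" where
  "smooth_set P R = {n::nat. 1 \<le> n \<and> real n \<le> P \<and>
      (\<forall>p::nat. prime p \<and> p dvd n \<longrightarrow> real p \<le> R)}"

definition e :: "real \<Rightarrow> complex" where
  "e z = exp (2 * of_real pi * \<i> * of_real z)"

definition weyl_f :: "nat \<Rightarrow> real \<Rightarrow> real \<Rightarrow> real \<Rightarrow> complex" where
  "weyl_f k \<alpha> P R = (\<Sum>x\<in>smooth_set P R. e (\<alpha> * real x ^ k))"

definition U :: "nat \<Rightarrow> real \<Rightarrow> real \<Rightarrow> real \<Rightarrow> real" where
  "U k s P R = (LINT \<alpha>:{0..1}|lborel. cmod (weyl_f k \<alpha> P R) powr s)"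

definition admissible_exponent :: "nat \<Rightarrow> real \<Rightarrow> real \<Rightarrow> bool" where
  "admissible_exponent k s \<Delta> \<longleftrightarrow>
     (\<forall>\<epsilon>>0. \<exists>\<eta>>0. \<exists>C. \<exists>P0. \<forall>P\<ge>P0. \<forall>R.
        1 \<le> R \<and> R \<le> P powr \<eta> \<longrightarrow> U k s P R \<le> C * P powr (s - real k + \<Delta> + \<epsilon>))"

definition major_arcs :: "nat \<Rightarrow> real \<Rightarrow> real \<Rightarrow> real set" where
  "major_arcs k Q P = {\<alpha>. 0 \<le> \<alpha> \<and> \<alpha> < 1 \<and>
     (\<exists>q a::int. 1 \<le> q \<and> real_of_int q \<le> Q \<and> 0 \<le> a \<and> a \<le> q \<and> coprime a q \<and>
        \<bar>real_of_int q * \<alpha> - real_of_int a\<bar> \<le> Q * P powr (- real k))}"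

end

theory Submission
  imports Defs
begin

text \<open>
Write $M = P Q^{-2/k}$ and let $\alpha$ lie on the arc around $a/q$. Apart from $O(M P^\varepsilon)$ terms,
every $x$ in the smooth sum factors as $x = m d z$ with $(m, q) = 1$ and $M < m \le MR$, with $d$ composed of
primes dividing $q$, and with $z$ smooth and otherwise unrestricted. Hoelder's inequality bounds
$|f(\alpha; P, R)|^s$ by a sum of $|f(\alpha m^k d^k; P/(md), r)|^s$. As $(m, q) = 1$, multiplication by $m^k$
permutes the fractions $a/q$ and dilates the arcs to width about $1/(qQ)$, so that the dilated arcs
cover the circle $O(P^\varepsilon)$ times; dilation by $d^k$ preserves integrals over a period. Hence each term
contributes at most $m^{-k} P^\varepsilon U_s(P/(md), r)$, which the admissible exponent controls. The sum
over $d$ costs only a logarithm because $s - k + \Delta_s \ge 1$, a consequence of Parseval's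
identity and $s \ge 2$.
\<close>

section \<open>Integers with prescribed prime factors\<close>

text \<open>Why three factors: multiplication by m^k permutes the reduced fractions with denominator
  q only if (m, q) = 1, but a smooth x may have most of its prime factors among those of q. These
  cannot enter m, and leaving the ones above r in z would spoil the r-smoothness of z; hence d.
  Since the primes of d divide q, there are only P^\<epsilon> choices of d up to P, and the same
  count bounds the exceptional x. The value of M comes from the covering. An arc is |q \<alpha> - a|
  <= Q P^(-k); its dilate by m^k is |q \<gamma> - b| <= m^k Q P^(-k), and at m = M the right side is
  1/Q, the largest size at which denominators up to Q overlap only logarithmically often. Smoothness
  supplies an m that overshoots M by at most a factor R, and bounded powers of R are absorbed in
  P^\<epsilon>.\<close>

definition prime_supported :: "nat set \<Rightarrow> nat \<Rightarrow> nat set" where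
  "prime_supported T N = {d. 1 \<le> d \<and> d \<le> N \<and> (\<forall>p. prime p \<and> p dvd d \<longrightarrow> p \<in> T)}"

lemma finite_prime_supported [simp]: "finite (prime_supported T N)"
  by (rule finite_subset[of _ "{..N}"]) (auto simp: prime_supported_def)

lemma prime_supported_insert:
  assumes "prime p"
  shows "prime_supported (insert p T) N \<subseteq> prime_supported T N \<union> (\<lambda>d. p * d) ` prime_supported (insert p T) (N div p)"
proof
  fix d assume d: "d \<in> prime_supported (insert p T) N"
  show "d \<in> prime_supported T N \<union> (\<lambda>d. p * d) ` prime_supported (insert p T) (N div p)"
  proof (cases "p dvd d")
    case True
    then obtain c where c: "d = p * c" by auto
    have "c \<ge> 1" using d c by (auto simp: prime_supported_def intro: Suc_leI)
    moreover have "c \<le> N div p"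
      using d c prime_gt_0_nat[OF assms]
      by (simp add: prime_supported_def less_eq_div_iff_mult_less_eq mult.commute)
    moreover have "\<forall>r. prime r \<and> r dvd c \<longrightarrow> r \<in> insert p T"
      using d c by (auto simp: prime_supported_def)
    ultimately have "c \<in> prime_supported (insert p T) (N div p)"
      by (simp add: prime_supported_def)
    then show ?thesis using c by auto
  next
    case False
    then show ?thesis using d by (auto simp: prime_supported_def)
  qed
qed

text \<open>Rankin's trick: the Euler product of d^(-\<delta>) over the primes in \<open>T\<close>
  has every factor at most 1/(1 - 2^(-\<delta>)). In inductive form, the multiples of p are counted
  at N/p, which gains a factor 2^(-\<delta>), and \<open>1 / B + 2 powr (-\<delta>) = 1\<close>
  closes the recursion.\<close>

lemma card_prime_supported_le:
  fixes \<delta> :: real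
  assumes "\<delta> > 0" "finite T" "\<And>p. p \<in> T \<Longrightarrow> prime p"
  shows "real (card (prime_supported T N)) \<le> (1 / (1 - 2 powr (-\<delta>))) ^ card T * real N powr \<delta>"
  using assms(2,3)
proof (induction T arbitrary: N)
  case empty
  have "prime_supported {} N \<subseteq> (if N = 0 then {} else {1})"
    using prime_factor_nat by (fastforce simp: prime_supported_def)
  then have "card (prime_supported {} N) \<le> card (if N = 0 then {} else {1::nat})"
    by (intro card_mono) auto
  moreover have "real (card (if N = 0 then {} else {1::nat})) \<le> real N powr \<delta>"
    using ge_one_powr_ge_zero[of "real N" \<delta>] assms(1) by auto
  ultimately show ?case by simp
next
  case (insert p T)
  define B where "B = 1 / (1 - 2 powr (-\<delta>))"
  have t: "2 powr (-\<delta>) < 1" "2 powr (-\<delta>) > 0" using assms(1) by (auto simp: powr_less_one)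
  have B1: "1 / B = 1 - 2 powr (-\<delta>)" "B > 0" using t by (auto simp: B_def)
  have p: "prime p" using insert.prems by auto
  show ?case unfolding B_def[symmetric]
  proof (induction N rule: less_induct)
    case (less N)
    show ?case
    proof (cases "N = 0")
      case True
      then show ?thesis by (auto simp: prime_supported_def)
    next
      case False
      have div: "N div p < N" using False prime_gt_1_nat[OF p] by simp
      have "card (prime_supported (insert p T) N) \<le>
              card (prime_supported T N) + card (prime_supported (insert p T) (N div p))"
        using card_mono[OF _ prime_supported_insert[OF p, of T N]]
          card_Un_le[of "prime_supported T N" "(\<lambda>d. p * d) ` prime_supported (insert p T) (N div p)"]
          card_image_le[of "prime_supported (insert p T) (N div p)" "\<lambda>d. p * d"] by simp
      then have "real (card (prime_supported (insert p T) N)) \<le>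
              real (card (prime_supported T N)) + real (card (prime_supported (insert p T) (N div p)))" by linarith
      also have "\<dots> \<le> B ^ card T * real N powr \<delta> + B ^ card (insert p T) * real (N div p) powr \<delta>"
        using less.IH[OF div] insert.IH[of N] insert.prems by (intro add_mono) (auto simp: B_def)
      also have "real (N div p) powr \<delta> \<le> (real N / 2) powr \<delta>"
      proof (intro powr_mono2)
        have "real (N div p) \<le> real N / real p" by (rule of_nat_div_le_of_nat)
        also have "\<dots> \<le> real N / 2" using prime_ge_2_nat[OF p] by (intro divide_left_mono) auto
        finally show "real (N div p) \<le> real N / 2" .
      qed (use assms(1) in auto)
      also have "(real N / 2) powr \<delta> = 2 powr (-\<delta>) * real N powr \<delta>"
        by (simp add: powr_divide powr_minus_divide)
      also have "B ^ card T * real N powr \<delta> + B ^ card (insert p T) * (2 powr (-\<delta>) * real N powr \<delta>)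
           = B ^ card (insert p T) * real N powr \<delta> * (1 / B + 2 powr (-\<delta>))"
        using insert.hyps B1(2) by (simp add: field_simps)
      also have "\<dots> = B ^ card (insert p T) * real N powr \<delta>" using B1 by simp
      finally show ?thesis using B1 by (simp add: mult_left_mono)
    qed
  qed
qed

text \<open>The primes below \<open>Z\<close> contribute at most the constant \<open>B ^ Z\<close>.
  Every other prime p dividing q has p^\<delta> >= B, and the product of these distinct primes is at
  most q.\<close>

lemma power_card_prime_factors_le:
  fixes B \<delta> :: real
  assumes "\<delta> > 0" "B \<ge> 1"
  obtains C where "C \<ge> 1" "\<And>q::nat. q \<ge> 1 \<Longrightarrow> B ^ card (prime_factors q) \<le> C * real q powr \<delta>"
proof
  define Z where "Z = nat \<lceil>B powr (1/\<delta>)\<rceil>"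
  show "B ^ Z \<ge> 1" using assms by simp
  fix q :: nat assume q: "q \<ge> 1"
  let ?L = "{p \<in> prime_factors q. p < Z}" and ?H = "{p \<in> prime_factors q. \<not> p < Z}"
  have "card (prime_factors q) = card ?L + card ?H"
    by (subst card_Un_disjoint[symmetric]) (auto intro: arg_cong[where f = card])
  then have "B ^ card (prime_factors q) = B ^ card ?L * B ^ card ?H" by (simp add: power_add)
  also have "\<dots> \<le> B ^ Z * real q powr \<delta>"
  proof (intro mult_mono)
    have "card ?L \<le> card {..<Z}" by (intro card_mono) auto
    then show "B ^ card ?L \<le> B ^ Z" using assms by (intro power_increasing) auto
    have "B ^ card ?H = (\<Prod>p\<in>?H. B)" by simp
    also have "\<dots> \<le> (\<Prod>p\<in>?H. real p powr \<delta>)"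
    proof (intro prod_mono conjI)
      fix p assume p: "p \<in> ?H"
      have "B = (B powr (1/\<delta>)) powr \<delta>" using assms by (simp add: powr_powr)
      also have "\<dots> \<le> real p powr \<delta>"
        using p assms by (intro powr_mono2) (auto simp: Z_def not_less nat_le_iff ceiling_le_iff)
      finally show "B \<le> real p powr \<delta>" .
    qed (use assms in auto)
    also have "\<dots> = real (\<Prod>?H) powr \<delta>"
      by (subst of_nat_prod, subst prod_powr_distrib) auto
    also have "\<dots> \<le> real q powr \<delta>"
    proof -
      have "\<Prod>?H dvd \<Prod>(prime_factors q)" by (intro prod_dvd_prod_subset) auto
      also have "\<Prod>(prime_factors q) dvd (\<Prod>p\<in>prime_factors q. p ^ multiplicity p q)"
        by (intro prod_dvd_prod) (auto simp: prime_factors_multiplicity intro: dvd_power)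
      also have "\<dots> = q" using q by (simp add: prime_factorization_nat[symmetric])
      finally have "\<Prod>?H \<le> q" using q by (intro dvd_imp_le) auto
      then show ?thesis using assms by (intro powr_mono2) (simp_all del: of_nat_prod)
    qed
    finally show "B ^ card ?H \<le> real q powr \<delta>" .
  qed (use assms in auto)
  finally show "B ^ card (prime_factors q) \<le> B ^ Z * real q powr \<delta>" .
qed

lemma card_prime_supported_prime_factors_le:
  fixes \<delta> :: real
  assumes "\<delta> > 0"
  obtains C where "C \<ge> 1"
    "\<And>q N. q \<ge> 1 \<Longrightarrow> real (card (prime_supported (prime_factors q) N)) \<le> C * (real q * real N) powr \<delta>"
proof -
  define B where "B = 1 / (1 - 2 powr (-\<delta>))"
  have "2 powr (-\<delta>) < 1" "2 powr (-\<delta>) > 0" using assms(1) by (auto simp: powr_less_one)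
  then have "B \<ge> 1" by (auto simp: B_def)
  from power_card_prime_factors_le[OF assms this] obtain C
    where C: "C \<ge> 1" "\<And>q::nat. q \<ge> 1 \<Longrightarrow> B ^ card (prime_factors q) \<le> C * real q powr \<delta>" by blast
  show ?thesis
  proof (rule that[OF C(1)])
    fix q N :: nat assume q: "q \<ge> 1"
    have "real (card (prime_supported (prime_factors q) N)) \<le> B ^ card (prime_factors q) * real N powr \<delta>"
      unfolding B_def using assms by (intro card_prime_supported_le) auto
    also have "\<dots> \<le> (C * real q powr \<delta>) * real N powr \<delta>"
      using C(2)[OF q] by (intro mult_right_mono) auto
    also have "\<dots> = C * (real q * real N) powr \<delta>" by (simp add: powr_mult)
    finally show "real (card (prime_supported (prime_factors q) N)) \<le> C * (real q * real N) powr \<delta>" .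
  qed
qed

lemma card_divisors_le:
  fixes \<delta> :: real
  assumes "\<delta> > 0"
  obtains C where "C \<ge> 1"
    "\<And>n::nat. n \<ge> 1 \<Longrightarrow> real (card {d. d dvd n}) \<le> C * real n powr \<delta>"
proof -
  \<comment> \<open>Half of \<delta>, because the bound is used with q = N = n.\<close>
  from card_prime_supported_prime_factors_le[of "\<delta>/2"] assms obtain C where C: "C \<ge> 1"
    "\<And>q N. q \<ge> 1 \<Longrightarrow> real (card (prime_supported (prime_factors q) N)) \<le> C * (real q * real N) powr (\<delta>/2)"
    by (metis half_gt_zero)
  show ?thesis
  proof (rule that[OF C(1)])
    fix n :: nat assume n: "n \<ge> 1"
    have "{d. d dvd n} \<subseteq> prime_supported (prime_factors n) n"
      using n by (auto simp: prime_supported_def prime_factors_dvd intro: dvd_imp_le dvd_trans Suc_leI dest: dvd_imp_le dvd_pos_nat)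
    then have "real (card {d. d dvd n}) \<le> real (card (prime_supported (prime_factors n) n))"
      by (intro of_nat_mono card_mono) auto
    also have "\<dots> \<le> C * (real n * real n) powr (\<delta>/2)" by (rule C(2)[OF n])
    also have "(real n * real n) powr (\<delta>/2) = real n powr \<delta>"
      by (simp add: powr_mult flip: powr_add)
    finally show "real (card {d. d dvd n}) \<le> C * real n powr \<delta>" .
  qed
qed

section \<open>A lower bound for the number of smooth integers\<close>

lemma finite_smooth_set [simp]: "finite (smooth_set P R)"
  by (rule finite_subset[of _ "{..nat \<lfloor>P\<rfloor>}"]) (auto simp: smooth_set_def le_nat_floor)

lemma prod_list_pos_nat: "\<forall>x\<in>set xs. (1::nat) \<le> x \<Longrightarrow> 1 \<le> prod_list xs"
  by (induction xs) auto

lemma prime_dvd_prod_list_nat: "prime (p::nat) \<Longrightarrow> p dvd prod_list xs \<Longrightarrow> \<exists>y\<in>set xs. p dvd y"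
  by (induction xs) (auto simp: prime_dvd_mult_iff)

lemma prod_list_le_power: "\<forall>x\<in>set xs. (x::nat) \<le> N \<Longrightarrow> prod_list xs \<le> N ^ length xs"
  by (induction xs) (auto intro: mult_mono)

text \<open>A product of J integers up to N, where N is about P^(1/J) and 1/J <= \<eta>, is
  P^\<eta>-smooth and at most P. The entries of such a list divide its product, so the divisor bound
  limits the number of lists with a given product, and the N^J lists must yield many
  products.\<close>

lemma card_smooth_set_ge:
  fixes \<eta> \<epsilon> :: real
  assumes "\<eta> > 0" "\<epsilon> > 0"
  obtains c where "c > 0" "\<And>P. P \<ge> 1 \<Longrightarrow> real (card (smooth_set P (P powr \<eta>))) \<ge> c * P powr (1 - \<epsilon>)"
proof -
  define J where "J = Suc (nat \<lceil>1 / \<eta>\<rceil>)"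
  have J: "real J > 0" "1 / real J \<le> \<eta>"
  proof -
    have "1 / \<eta> \<le> real J" unfolding J_def by linarith
    then show "1 / real J \<le> \<eta>" using assms frac_le[of 1 1 "1 / \<eta>" "real J"] by simp
  qed (simp add: J_def)
  \<comment> \<open>The fibres are bounded by a J-th power of the divisor bound, so each factor may
    cost P^(\<epsilon>/J).\<close>
  from card_divisors_le[of "\<epsilon> / real J"] assms J obtain C where C: "C \<ge> 1"
    "\<And>n::nat. n \<ge> 1 \<Longrightarrow> real (card {d. d dvd n}) \<le> C * real n powr (\<epsilon> / real J)"
    by (metis divide_pos_pos)
  show ?thesis
  proof (rule that)
    show "1 / (2 * C) ^ J > 0" using C by simp
    fix P :: real assume P: "P \<ge> 1"
    define N where "N = nat \<lfloor>P powr (1 / real J)\<rfloor>"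
    have P1: "P powr (1 / real J) \<ge> 1" using P J by (intro ge_one_powr_ge_zero) auto
    have N: "real N \<le> P powr (1 / real J)" "P powr (1 / real J) / 2 \<le> real N" "N \<ge> 1"
    proof -
      have f: "\<lfloor>P powr (1 / real J)\<rfloor> \<ge> 1" using P1 by simp
      then have "real N = of_int \<lfloor>P powr (1 / real J)\<rfloor>" unfolding N_def by (subst of_nat_nat) linarith+
      then show "real N \<le> P powr (1 / real J)" "P powr (1 / real J) / 2 \<le> real N" "N \<ge> 1"
        using P1 f by linarith+
    qed
    have PJ: "(P powr (1 / real J)) ^ J = P"
      using P J by (simp flip: powr_realpow add: powr_powr)
    define L where "L = {xs. set xs \<subseteq> {1..N} \<and> length xs = J}"
    have finL: "finite L" unfolding L_def by (rule finite_lists_length_eq) auto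
    have cardL: "card L = N ^ J" unfolding L_def by (subst card_lists_length_eq) auto
    have im: "prod_list ` L \<subseteq> smooth_set P (P powr \<eta>)"
    proof
      fix x assume "x \<in> prod_list ` L"
      then obtain xs where xs: "set xs \<subseteq> {1..N}" "length xs = J" "x = prod_list xs"
        by (auto simp: L_def)
      have xs_le: "\<forall>y\<in>set xs. 1 \<le> y" "\<forall>y\<in>set xs. y \<le> N" using xs(1) by (meson atLeastAtMost_iff subsetD)+
      have "prod_list xs \<le> N ^ J" using prod_list_le_power[OF xs_le(2)] xs by simp
      then have "real x \<le> real N ^ J" using xs by (metis of_nat_mono of_nat_power)
      also have "\<dots> \<le> (P powr (1 / real J)) ^ J" using N by (intro power_mono) auto
      finally have "real x \<le> P" using PJ by simp
      moreover have "1 \<le> x" using prod_list_pos_nat[OF xs_le(1)] xs by simp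
      moreover have "real p \<le> P powr \<eta>" if p: "prime p" "p dvd x" for p
      proof -
        obtain y where y: "y \<in> set xs" "p dvd y"
          using prime_dvd_prod_list_nat[OF p(1)] p xs by auto
        then have "p \<le> y" using xs_le by (intro dvd_imp_le) auto
        then have "p \<le> N" using xs_le y by (meson le_trans)
        then have "real p \<le> P powr (1 / real J)" using N by linarith
        also have "\<dots> \<le> P powr \<eta>" using P J by (intro powr_mono) auto
        finally show ?thesis .
      qed
      ultimately show "x \<in> smooth_set P (P powr \<eta>)" by (auto simp: smooth_set_def)
    qed
    have fib: "real (card {xs \<in> L. prod_list xs = x}) \<le> (C * P powr (\<epsilon> / real J)) ^ J"
      if x: "x \<in> prod_list ` L" for x
    proof -
      have xP: "1 \<le> x" "real x \<le> P" using im x by (auto simp: smooth_set_def)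
      have fin: "finite {d. d dvd x}" using xP by simp
      have "{xs \<in> L. prod_list xs = x} \<subseteq> {xs. set xs \<subseteq> {d. d dvd x} \<and> length xs = J}"
        unfolding L_def by (blast intro: prod_list_dvd)
      then have "card {xs \<in> L. prod_list xs = x} \<le> card {d. d dvd x} ^ J"
        using card_mono[OF finite_lists_length_eq[OF fin, of J]] unfolding card_lists_length_eq[OF fin, of J]
        by blast
      then have "real (card {xs \<in> L. prod_list xs = x}) \<le> real (card {d. d dvd x}) ^ J"
        by (simp flip: of_nat_power)
      also have "\<dots> \<le> (C * real x powr (\<epsilon> / real J)) ^ J"
        using C(2)[of x] xP by (intro power_mono) auto
      also have "\<dots> \<le> (C * P powr (\<epsilon> / real J)) ^ J"
        using C xP assms J by (intro power_mono mult_left_mono powr_mono2) auto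
      finally show ?thesis .
    qed
    have "card L = (\<Sum>x\<in>prod_list ` L. card {xs \<in> L. prod_list xs = x})"
      unfolding card_eq_sum by (rule sum.image_gen[OF finL])
    then have "real (card L) = (\<Sum>x\<in>prod_list ` L. real (card {xs \<in> L. prod_list xs = x}))"
      unfolding of_nat_sum[symmetric] by (rule arg_cong)
    then have "real N ^ J = (\<Sum>x\<in>prod_list ` L. real (card {xs \<in> L. prod_list xs = x}))"
      unfolding cardL of_nat_power .
    also have "\<dots> \<le> (\<Sum>x\<in>prod_list ` L. (C * P powr (\<epsilon> / real J)) ^ J)"
      using fib by (intro sum_mono) auto
    also have "\<dots> = real (card (prod_list ` L)) * (C ^ J * P powr \<epsilon>)"
      using P J by (simp add: power_mult_distrib powr_powr flip: powr_realpow)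
    also have "\<dots> \<le> real (card (smooth_set P (P powr \<eta>))) * (C ^ J * P powr \<epsilon>)"
      using C im by (intro mult_right_mono of_nat_mono card_mono) auto
    finally have 1: "real N ^ J \<le> real (card (smooth_set P (P powr \<eta>))) * (C ^ J * P powr \<epsilon>)" .
    have "P / 2 ^ J = (P powr (1 / real J) / 2) ^ J" using PJ by (simp add: power_divide)
    also have "\<dots> \<le> real N ^ J" using N by (intro power_mono) auto
    finally have "P / 2 ^ J \<le> real (card (smooth_set P (P powr \<eta>))) * (C ^ J * P powr \<epsilon>)"
      using 1 by linarith
    then have "P / (2 ^ J * (C ^ J * P powr \<epsilon>)) \<le> real (card (smooth_set P (P powr \<eta>)))"
      using C P by (simp add: field_simps)
    moreover have "P / (2 ^ J * (C ^ J * P powr \<epsilon>)) = 1 / (2 * C) ^ J * P powr (1 - \<epsilon>)"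
      using P by (simp add: powr_diff power_mult_distrib)
    ultimately show "1 / (2 * C) ^ J * P powr (1 - \<epsilon>) \<le> real (card (smooth_set P (P powr \<eta>)))"
      by linarith
  qed
qed

section \<open>Weyl sums and admissible exponents\<close>

lemma norm_e [simp]: "norm (e x) = 1"
  by (simp add: e_def norm_exp_eq_Re)

lemma e_add: "e (x + y) = e x * e y"
  by (simp add: e_def ring_distribs exp_add)

lemma e_of_int [simp]: "e (of_int n) = 1"
  unfolding e_def by (auto simp: exp_eq_1 intro!: exI[of _ n])

lemma continuous_on_e: "continuous_on UNIV e"
  unfolding e_def by (intro continuous_intros)

lemma continuous_on_weyl_f: "continuous_on UNIV (\<lambda>\<alpha>. weyl_f k \<alpha> P R)"
  unfolding weyl_f_def e_def by (intro continuous_intros)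

lemma continuous_on_weyl_f_powr:
  "s > 0 \<Longrightarrow> continuous_on A (\<lambda>\<alpha>. cmod (weyl_f k \<alpha> P R) powr s)"
  by (intro continuous_on_powr' continuous_on_norm continuous_intros
        continuous_on_subset[OF continuous_on_weyl_f]) auto

lemma weyl_f_add_int: "weyl_f k (\<alpha> + of_int h) P R = weyl_f k \<alpha> P R"
proof -
  have "e ((\<alpha> + of_int h) * real x ^ k) = e (\<alpha> * real x ^ k)" for x
  proof -
    have "(\<alpha> + of_int h) * real x ^ k = \<alpha> * real x ^ k + of_int (h * int x ^ k)"
      by (simp add: ring_distribs)
    then show ?thesis by (simp only: e_add e_of_int mult_1_right)
  qed
  then show ?thesis by (simp add: weyl_f_def)
qed

lemma norm_weyl_f_le_card: "cmod (weyl_f k \<alpha> P R) \<le> real (card (smooth_set P R))"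
  unfolding weyl_f_def using norm_sum[of "\<lambda>x. e (\<alpha> * real x ^ k)" "smooth_set P R"] by simp

lemma card_smooth_set_le: "P \<ge> 0 \<Longrightarrow> real (card (smooth_set P R)) \<le> P"
proof -
  assume "P \<ge> 0"
  have "smooth_set P R \<subseteq> {1..nat \<lfloor>P\<rfloor>}" by (auto simp: smooth_set_def le_nat_floor)
  then have "card (smooth_set P R) \<le> nat \<lfloor>P\<rfloor>" using card_mono[of "{1..nat \<lfloor>P\<rfloor>}"] by fastforce
  then show ?thesis using \<open>P \<ge> 0\<close> by linarith
qed

lemma norm_weyl_f_le: "P \<ge> 0 \<Longrightarrow> cmod (weyl_f k \<alpha> P R) \<le> P"
  using norm_weyl_f_le_card card_smooth_set_le order_trans by blast

lemma set_integrable_weyl_f_powr: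
  "s > 0 \<Longrightarrow> set_integrable lborel {0..1::real} (\<lambda>\<alpha>. cmod (weyl_f k \<alpha> P R) powr s)"
  by (rule borel_integrable_atLeastAtMost') (auto intro: continuous_on_weyl_f_powr)

lemma U_le:
  assumes "s > 0" "P \<ge> 0"
  shows "U k s P R \<le> P powr s"
proof -
  have "U k s P R \<le> (LINT \<alpha>:{0..1::real}|lborel. P powr s)"
    unfolding U_def using assms
    by (intro set_integral_mono set_integrable_weyl_f_powr powr_mono2 norm_weyl_f_le
          borel_integrable_atLeastAtMost') auto
  also have "\<dots> = P powr s" by (simp add: set_lebesgue_integral_def)
  finally show ?thesis .
qed

section \<open>Orthogonality and the mean square\<close>

lemma integral_e_int:
  "(LINT \<alpha>:{0..1::real}|lborel. Re (e (\<alpha> * of_int n))) = (if n = 0 then 1 else 0)"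
proof (cases "n = 0")
  case True
  then show ?thesis by (simp add: e_def set_lebesgue_integral_def)
next
  case False
  have Re: "Re (e (\<alpha> * of_int n)) = cos (2 * pi * of_int n * \<alpha>)" for \<alpha>
    by (simp add: e_def Re_exp mult_ac)
  define c where "c = 2 * pi * of_int n"
  have c: "c \<noteq> 0" using False by (simp add: c_def)
  have "((\<lambda>\<alpha>. cos (c * \<alpha>)) has_integral (sin (c * 1) / c - sin (c * 0) / c)) {0..1}"
    using c by (intro fundamental_theorem_of_calculus)
      (auto intro!: derivative_eq_intros simp flip: has_real_derivative_iff_has_vector_derivative)
  moreover have "sin c = 0" unfolding c_def using sin_integer_2pi[of "of_int n"] by simp
  ultimately have "((\<lambda>\<alpha>. cos (c * \<alpha>)) has_integral 0) {0..1}" by simp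
  moreover have "set_integrable lborel {0..1::real} (\<lambda>\<alpha>. cos (c * \<alpha>))"
    by (rule borel_integrable_atLeastAtMost') (auto intro!: continuous_intros)
  ultimately have "(LINT \<alpha>:{0..1::real}|lborel. cos (c * \<alpha>)) = 0"
    using set_borel_integral_eq_integral(2) by fastforce
  then show ?thesis using False unfolding Re c_def by simp
qed

lemma set_integrable_sum:
  fixes f :: "'i \<Rightarrow> 'a \<Rightarrow> real"
  assumes "\<And>i. set_integrable M A (f i)"
  shows "set_integrable M A (\<lambda>x. \<Sum>i\<in>I. f i x)"
  using assms unfolding set_integrable_def scaleR_sum_right
  by (intro Bochner_Integration.integrable_sum)

lemma set_integral_sum:
  fixes f :: "'i \<Rightarrow> 'a \<Rightarrow> real"
  assumes "\<And>i. set_integrable M A (f i)"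
  shows "(LINT x:A|M. \<Sum>i\<in>I. f i x) = (\<Sum>i\<in>I. LINT x:A|M. f i x)"
  using assms unfolding set_integrable_def set_lebesgue_integral_def scaleR_sum_right
  by (intro Bochner_Integration.integral_sum)

text \<open>Parseval: terms with x^k different from y^k integrate to 0, and k >= 1 turns x^k = y^k
  into x = y.\<close>

lemma mean_square_weyl_f:
  assumes "k \<ge> 1"
  shows "(LINT \<alpha>:{0..1::real}|lborel. cmod (weyl_f k \<alpha> P R) powr 2) = real (card (smooth_set P R))"
proof -
  let ?A = "smooth_set P R"
  have e_cnj: "e x * cnj (e y) = e (x - y)" for x y
  proof -
    have "cnj (e y) = e (- y)" by (simp add: e_def exp_cnj)
    then show ?thesis by (simp flip: e_add)
  qed
  have "cmod (weyl_f k \<alpha> P R) powr 2 = (\<Sum>x\<in>?A. \<Sum>y\<in>?A. Re (e (\<alpha> * of_int (int x ^ k - int y ^ k))))" for \<alpha>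
  proof -
    have "of_real (cmod (weyl_f k \<alpha> P R) ^ 2) = weyl_f k \<alpha> P R * cnj (weyl_f k \<alpha> P R)"
      by (rule complex_norm_square)
    also have "\<dots> = (\<Sum>x\<in>?A. \<Sum>y\<in>?A. e (\<alpha> * of_int (int x ^ k - int y ^ k)))"
      unfolding weyl_f_def by (simp add: sum_product cnj_sum e_cnj ring_distribs)
    finally have "cmod (weyl_f k \<alpha> P R) ^ 2 = Re (\<Sum>x\<in>?A. \<Sum>y\<in>?A. e (\<alpha> * of_int (int x ^ k - int y ^ k)))"
      by (metis Re_complex_of_real)
    then show ?thesis by (simp add: powr_numeral)
  qed
  then have "(LINT \<alpha>:{0..1::real}|lborel. cmod (weyl_f k \<alpha> P R) powr 2) =
     (LINT \<alpha>:{0..1::real}|lborel. (\<Sum>x\<in>?A. \<Sum>y\<in>?A. Re (e (\<alpha> * of_int (int x ^ k - int y ^ k)))))"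
    by simp
  also have int: "set_integrable lborel {0..1::real} (\<lambda>\<alpha>. Re (e (\<alpha> * of_int n)))" for n
    by (rule borel_integrable_atLeastAtMost')
       (auto intro!: continuous_intros continuous_on_compose2[OF continuous_on_e])
  have "(LINT \<alpha>:{0..1::real}|lborel. (\<Sum>x\<in>?A. \<Sum>y\<in>?A. Re (e (\<alpha> * of_int (int x ^ k - int y ^ k)))))
      = (\<Sum>x\<in>?A. \<Sum>y\<in>?A. LINT \<alpha>:{0..1::real}|lborel. Re (e (\<alpha> * of_int (int x ^ k - int y ^ k))))"
    by (simp only: set_integral_sum set_integrable_sum int)
  also have "\<dots> = (\<Sum>x\<in>?A. \<Sum>y\<in>?A. if x = y then 1 else 0)"
  proof (intro sum.cong refl)
    fix x y
    have "int x ^ k - int y ^ k = 0 \<longleftrightarrow> x = y"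
      using assms power_eq_iff_eq_base[of k x y] by (simp flip: of_nat_power)
    then show "(LINT \<alpha>:{0..1::real}|lborel. Re (e (\<alpha> * of_int (int x ^ k - int y ^ k)))) = (if x = y then 1 else 0)"
      unfolding integral_e_int by simp
  qed
  also have "\<dots> = real (card ?A)" by (simp add: sum.delta)
  finally show ?thesis .
qed

text \<open>The pointwise bound u^2 <= 1 + u^s for s >= 2 compares the mean square with the s-th
  moment. The 1 takes care of u <= 1 and is harmless because the count grows with P in the
  application.\<close>

lemma card_smooth_set_le_U:
  assumes "k \<ge> 1" "s \<ge> 2"
  shows "real (card (smooth_set P R)) \<le> 1 + U k s P R"
proof -
  have pt: "u powr 2 \<le> 1 + u powr s" if "u \<ge> 0" for u :: real
  proof (cases "u \<le> 1")
    case True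
    then have "u powr 2 \<le> 1 powr 2" using that by (intro powr_mono2) auto
    then show ?thesis by (simp add: add_increasing2)
  next
    case False
    then have "u powr 2 \<le> u powr s" using assms by (intro powr_mono) auto
    then show ?thesis by simp
  qed
  have one: "set_integrable lborel {0..1::real} (\<lambda>\<alpha>. 1::real)"
    by (rule borel_integrable_atLeastAtMost') auto
  have "real (card (smooth_set P R)) \<le> (LINT \<alpha>:{0..1::real}|lborel. 1 + cmod (weyl_f k \<alpha> P R) powr s)"
    unfolding mean_square_weyl_f[OF assms(1), symmetric]
    using assms by (intro set_integral_mono set_integral_add(1) set_integrable_weyl_f_powr pt one) auto
  also have "\<dots> = 1 + U k s P R"
    using assms one by (subst set_integral_add(2)) (auto intro: set_integrable_weyl_f_powr simp: U_def set_lebesgue_integral_def)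
  finally show ?thesis .
qed

text \<open>
Smooth numbers up to $P$ number at least $P^{1-\varepsilon}$, and Parseval bounds $U_s$ from below by their count.
\<close>

lemma admissible_exponent_ge:
  assumes "k \<ge> 1" "s \<ge> 2" "admissible_exponent k s \<Delta>"
  shows "s - real k + \<Delta> \<ge> 1"
proof (rule ccontr)
  define \<sigma> where "\<sigma> = s - real k + \<Delta>"
  assume "\<not> s - real k + \<Delta> \<ge> 1"
  then have \<sigma>: "\<sigma> < 1" by (simp add: \<sigma>_def)
  \<comment> \<open>One third of 1 - \<sigma> keeps \<sigma> + \<epsilon> below 1 - \<epsilon>; the
    cap 1/2 keeps 1 - \<epsilon> positive, so that P^(-(1 - \<epsilon>)) tends to 0.\<close>
  define \<epsilon> where "\<epsilon> = min (1/2) ((1 - \<sigma>) / 3)"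
  have \<epsilon>: "\<epsilon> > 0" "\<sigma> + \<epsilon> < 1 - \<epsilon>" "0 < 1 - \<epsilon>" 
  proof -
    have "\<epsilon> \<le> (1 - \<sigma>) / 3" "\<epsilon> \<le> 1 / 2" unfolding \<epsilon>_def by (rule min.cobounded2, rule min.cobounded1)
    then show "\<sigma> + \<epsilon> < 1 - \<epsilon>" "0 < 1 - \<epsilon>" using \<sigma> by auto
  qed (use \<sigma> in \<open>simp add: \<epsilon>_def\<close>)
  from assms(3) \<epsilon> obtain \<eta> C P0 where U: "\<eta> > 0"
    "\<And>P R. P \<ge> P0 \<Longrightarrow> 1 \<le> R \<Longrightarrow> R \<le> P powr \<eta> \<Longrightarrow> U k s P R \<le> C * P powr (\<sigma> + \<epsilon>)"
    unfolding admissible_exponent_def \<sigma>_def by metis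
  from card_smooth_set_ge[OF U(1) \<epsilon>(1)] obtain c where c: "c > 0"
    "\<And>P. P \<ge> 1 \<Longrightarrow> real (card (smooth_set P (P powr \<eta>))) \<ge> c * P powr (1 - \<epsilon>)" by blast
  have ev: "\<forall>\<^sub>F P in at_top. c * P powr (1 - \<epsilon>) \<le> 1 + C * P powr (\<sigma> + \<epsilon>)"
    using eventually_ge_at_top[of "max 1 P0"]
  proof eventually_elim
    case (elim P)
    have "c * P powr (1 - \<epsilon>) \<le> real (card (smooth_set P (P powr \<eta>)))" using c elim by auto
    also have "\<dots> \<le> 1 + U k s P (P powr \<eta>)" by (rule card_smooth_set_le_U[OF assms(1,2)])
    also have "U k s P (P powr \<eta>) \<le> C * P powr (\<sigma> + \<epsilon>)"
      using elim U(1) by (intro U(2)) (auto intro: ge_one_powr_ge_zero)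
    finally show ?case by simp
  qed
  \<comment> \<open>After division by P^(1 - \<epsilon>) the upper bound tends to 0, against the
    positive constant \<open>c\<close>.\<close>
  have "((\<lambda>P. P powr (-(1 - \<epsilon>)) + C * P powr (-(1 - \<epsilon> - (\<sigma> + \<epsilon>)))) \<longlongrightarrow> 0 + C * 0) at_top"
    using \<epsilon> by (intro tendsto_intros tendsto_neg_powr filterlim_ident) auto
  then have "\<forall>\<^sub>F P in at_top. P powr (-(1 - \<epsilon>)) + C * P powr (-(1 - \<epsilon> - (\<sigma> + \<epsilon>))) < c"
    using c by (intro order_tendstoD) auto
  with ev eventually_ge_at_top[of 1] have "\<forall>\<^sub>F P in (at_top :: real filter). False"
  proof eventually_elim
    case (elim P)
    have "c * P powr (1 - \<epsilon>) > (P powr (-(1 - \<epsilon>)) + C * P powr (-(1 - \<epsilon> - (\<sigma> + \<epsilon>)))) * P powr (1 - \<epsilon>)"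
      using elim by (intro mult_strict_right_mono) auto
    also have "(P powr (-(1 - \<epsilon>)) + C * P powr (-(1 - \<epsilon> - (\<sigma> + \<epsilon>)))) * P powr (1 - \<epsilon>)
        = 1 + C * P powr (\<sigma> + \<epsilon>)"
      using elim by (simp add: ring_distribs mult.assoc add.commute flip: powr_add)
    finally show ?case using elim by linarith
  qed
  then show False by (simp add: trivial_limit_at_top_linorder)
qed

text \<open>The inner sums have arbitrary length Y between 1 and P, while R is small only in terms
  of P, so admissibility does not apply directly. It serves when R <= Y^\<eta>0; otherwise Y is so
  short that the trivial bound Y^s is at most P^\<epsilon>. Lengths below \<open>P0\<close> go into
  the constant.\<close>

lemma U_uniform_bound:
  assumes "k \<ge> 1" "s \<ge> 2" "admissible_exponent k s \<Delta>" "\<epsilon> > 0"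
  obtains \<eta> C where "\<eta> > 0" "C \<ge> 1"
    "\<And>P Y R. 1 \<le> Y \<Longrightarrow> Y \<le> P \<Longrightarrow> 1 \<le> R \<Longrightarrow> R \<le> P powr \<eta> \<Longrightarrow>
       U k s Y R \<le> C * P powr \<epsilon> * Y powr (s - real k + \<Delta>)"
proof -
  define \<sigma> where "\<sigma> = s - real k + \<Delta>"
  have \<sigma>: "\<sigma> \<ge> 1" unfolding \<sigma>_def by (rule admissible_exponent_ge[OF assms(1-3)])
  from assms(3,4) obtain \<eta>0 C0 P0 where U: "\<eta>0 > 0"
    "\<And>P R. P \<ge> P0 \<Longrightarrow> 1 \<le> R \<Longrightarrow> R \<le> P powr \<eta>0 \<Longrightarrow> U k s P R \<le> C0 * P powr (\<sigma> + \<epsilon>)"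
    unfolding admissible_exponent_def \<sigma>_def by metis
  define C where "C = 1 + \<bar>C0\<bar> + \<bar>P0\<bar> powr s"
  have C1: "C \<ge> 1" by (simp add: C_def)
  \<comment> \<open>Chosen so that Y^\<eta>0 < R <= P^\<eta> implies Y^s <= P^\<epsilon>.\<close>
  define \<eta> where "\<eta> = \<epsilon> * \<eta>0 / s"
  show ?thesis
  proof (rule that)
    show "\<eta> > 0" using assms U by (simp add: \<eta>_def)
    show "C \<ge> 1" using C1 .
    fix P Y R :: real assume Y: "1 \<le> Y" "Y \<le> P" and R: "1 \<le> R" "R \<le> P powr \<eta>"
    have P\<epsilon>: "P powr \<epsilon> \<ge> 1" using Y assms by (intro ge_one_powr_ge_zero) auto
    have Y\<sigma>: "Y powr \<sigma> \<ge> 1" using Y \<sigma> by (intro ge_one_powr_ge_zero) auto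
    consider "Y < P0" | "Y \<ge> P0" "R \<le> Y powr \<eta>0" | "R > Y powr \<eta>0" by linarith
    then have "U k s Y R \<le> C * P powr \<epsilon> * Y powr \<sigma>"
    proof cases
      case 1
      have "U k s Y R \<le> Y powr s" using assms Y by (intro U_le) auto
      also have "\<dots> \<le> \<bar>P0\<bar> powr s" using 1 Y assms by (intro powr_mono2) auto
      also have "\<dots> \<le> C" by (simp add: C_def)
      also have "\<dots> \<le> C * P powr \<epsilon> * Y powr \<sigma>"
        using mult_mono[OF P\<epsilon> Y\<sigma>] mult_left_mono[of 1 "P powr \<epsilon> * Y powr \<sigma>" C] by (simp add: C_def mult.assoc)
      finally show ?thesis .
    next
      case 2
      have "U k s Y R \<le> C0 * Y powr (\<sigma> + \<epsilon>)" using 2 R by (intro U) auto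
      also have "\<dots> \<le> C * Y powr (\<sigma> + \<epsilon>)" proof (intro mult_right_mono)
        show "C0 \<le> C" unfolding C_def using abs_ge_self[of C0] powr_ge_zero[of "\<bar>P0\<bar>" s] by linarith
      qed auto
      also have "\<dots> = C * Y powr \<epsilon> * Y powr \<sigma>" by (simp add: powr_add)
      also have "\<dots> \<le> C * P powr \<epsilon> * Y powr \<sigma>"
        using Y assms by (intro mult_right_mono mult_left_mono powr_mono2) (auto simp: C_def)
      finally show ?thesis .
    next
      case 3
      have "Y powr \<eta>0 \<le> P powr \<eta>" using 3 R by linarith
      then have "(Y powr \<eta>0) powr (s / \<eta>0) \<le> (P powr \<eta>) powr (s / \<eta>0)"
        using assms U by (intro powr_mono2) auto
      then have "Y powr s \<le> P powr \<epsilon>" using assms U by (simp add: powr_powr \<eta>_def)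
      then have "U k s Y R \<le> P powr \<epsilon>" using U_le[of s Y k R] assms Y by linarith
      also have "\<dots> \<le> P powr \<epsilon> * (C * Y powr \<sigma>)"
        using mult_mono[OF C1 Y\<sigma>] C1
          mult_left_mono[of 1 "C * Y powr \<sigma>" "P powr \<epsilon>"] by simp
      finally show ?thesis by (simp add: mult_ac)
    qed
    then show "U k s Y R \<le> C * P powr \<epsilon> * Y powr (s - real k + \<Delta>)" by (simp add: \<sigma>_def)
  qed
qed

section \<open>Extracting a divisor coprime to $q$\<close>

lemma prime_split:
  fixes n :: nat
  assumes "n \<ge> 1"
  shows "\<exists>a b. n = a * b \<and> (\<forall>p. prime p \<and> p dvd a \<longrightarrow> Q p) \<and> (\<forall>p. prime p \<and> p dvd b \<longrightarrow> \<not> Q p)"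
  using assms
proof (induction n rule: less_induct)
  case (less n)
  show ?case
  proof (cases "n = 1")
    case True
    then show ?thesis by (intro exI[of _ 1]) auto
  next
    case False
    then obtain p c where p: "prime p" "n = p * c"
      using prime_factor_nat[of n] by (auto elim: dvdE)
    have "c < n" "c \<ge> 1" using p less.prems prime_gt_1_nat[OF p(1)] by auto
    from less.IH[OF this] obtain a b where ab: "c = a * b"
      "\<forall>p. prime p \<and> p dvd a \<longrightarrow> Q p" "\<forall>p. prime p \<and> p dvd b \<longrightarrow> \<not> Q p" by blast
    show ?thesis
    proof (cases "Q p")
      case True
      then have "\<forall>r. prime r \<and> r dvd p * a \<longrightarrow> Q r"
        using ab p(1) by (metis prime_dvd_mult_iff primes_dvd_imp_eq)
      then show ?thesis using ab p by (intro exI[of _ "p * a"] exI[of _ b]) auto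
    next
      case False
      then have "\<forall>r. prime r \<and> r dvd p * b \<longrightarrow> \<not> Q r"
        using ab p(1) by (metis prime_dvd_mult_iff primes_dvd_imp_eq)
      then show ?thesis using ab p by (intro exI[of _ "a"] exI[of _ "p * b"]) auto
    qed
  qed
qed

text \<open>Collects the primes of y in decreasing order until M is exceeded, seen from the other
  end: the least prime factor r is moved into z as long as the cofactor c still exceeds M. Once c <=
  M < r c, the choice l = c, z = 1 works.\<close>

lemma greedy_divisor:
  fixes y :: nat and M :: real
  assumes "M \<ge> 1" "M < real y"
  shows "\<exists>r l z. prime r \<and> y = r * l * z \<and> real l \<le> M \<and> M < real (r * l) \<and>
           (\<forall>p. prime p \<and> p dvd r * l \<longrightarrow> r \<le> p) \<and> (\<forall>p. prime p \<and> p dvd z \<longrightarrow> p \<le> r)"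
  using assms(2)
proof (induction y rule: less_induct)
  case (less y)
  define r where "r = (LEAST p. prime p \<and> p dvd y)"
  have "y \<noteq> 1" "y > 0" using assms less.prems by auto
  then obtain p where "prime p \<and> p dvd y" using prime_factor_nat by blast
  then have "prime r \<and> r dvd y" unfolding r_def by (rule LeastI)
  then have r: "prime r" "r dvd y" by auto
  have r_le: "r \<le> p" if "prime p" "p dvd y" for p unfolding r_def using that by (intro Least_le) auto
  obtain c where c: "y = r * c" using r by auto
  show ?case
  proof (cases "real c \<le> M")
    case True
    then show ?thesis using r r_le c less.prems
      by (intro exI[of _ r] exI[of _ c] exI[of _ 1]) auto
  next
    case False
    have "c < y" using c \<open>y > 0\<close> prime_gt_1_nat[OF r(1)] by auto
    from less.IH[OF this] False obtain r' l z where IH: "prime r'" "c = r' * l * z" "real l \<le> M"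
       "M < real (r' * l)" "\<forall>p. prime p \<and> p dvd r' * l \<longrightarrow> r' \<le> p" "\<forall>p. prime p \<and> p dvd z \<longrightarrow> p \<le> r'"
      by (meson not_le)
    have "r \<le> r'" using r_le[of r'] IH c by auto
    then have "\<forall>p. prime p \<and> p dvd z * r \<longrightarrow> p \<le> r'"
      using IH(6) r(1) by (metis prime_dvd_mult_iff primes_dvd_imp_eq)
    then show ?thesis using IH c
      by (intro exI[of _ r'] exI[of _ l] exI[of _ "z * r"]) auto
  qed
qed

text \<open>
The order of extraction makes the factorisation $x = m d z$ unique: $m$ collects the prime factors
of $x$ not dividing $q$ in decreasing order until $M$ is exceeded, $r$ is the last prime
collected, and $d$ collects the primes above $r$ that divide $q$. Then $z$ ranges over all
$r$-smooth numbers, with no coprimality condition left.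
\<close>

definition leaf :: "real \<Rightarrow> nat \<Rightarrow> nat \<times> nat \<times> nat \<Rightarrow> bool" where
  "leaf M q = (\<lambda>(r, m, d). prime r \<and> (\<exists>l. m = r * l \<and> real l \<le> M) \<and> M < real m \<and>
     (\<forall>p. prime p \<and> p dvd m \<longrightarrow> r \<le> p \<and> \<not> p dvd q) \<and> 1 \<le> d \<and>
     (\<forall>p. prime p \<and> p dvd d \<longrightarrow> r < p \<and> p dvd q))"

definition leaf_of :: "nat \<Rightarrow> nat \<times> nat \<times> nat \<Rightarrow> bool" where
  "leaf_of x = (\<lambda>(r, m, d). \<exists>z\<ge>1. x = m * d * z \<and> (\<forall>p. prime p \<and> p dvd z \<longrightarrow> p \<le> r))"

text \<open>The last hypothesis excludes the exceptional x = y u with y <= M and u built from primes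
  of q. For any other x the part y prime to q exceeds M, so the greedy divisor exists. The part u is
  cut at r: its primes above r form d, the rest joins z.\<close>

lemma exists_leaf:
  assumes "M \<ge> 1" "q \<ge> 1" "x \<ge> 1"
    and "\<And>y u. x = y * u \<Longrightarrow> real y \<le> M \<Longrightarrow> (\<forall>p. prime p \<and> p dvd u \<longrightarrow> p dvd q) \<Longrightarrow> False"
  shows "\<exists>t. leaf M q t \<and> leaf_of x t"
proof -
  obtain y u where yu: "x = y * u" "\<forall>p. prime p \<and> p dvd y \<longrightarrow> \<not> p dvd q"
    "\<forall>p. prime p \<and> p dvd u \<longrightarrow> p dvd q"
    using prime_split[OF assms(3), of "\<lambda>p. \<not> p dvd q"] by auto
  have "M < real y" using assms(4)[OF yu(1) _ yu(3)] not_le by blast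
  from greedy_divisor[OF assms(1) this] obtain r l z where rlz: "prime r" "y = r * l * z"
     "real l \<le> M" "M < real (r * l)" "\<forall>p. prime p \<and> p dvd r * l \<longrightarrow> r \<le> p"
     "\<forall>p. prime p \<and> p dvd z \<longrightarrow> p \<le> r" by blast
  have u: "u \<ge> 1" using yu assms by (cases u) auto
  obtain d w where dw: "u = d * w" "\<forall>p. prime p \<and> p dvd d \<longrightarrow> r < p" "\<forall>p. prime p \<and> p dvd w \<longrightarrow> \<not> r < p"
    using prime_split[OF u, of "\<lambda>p. r < p"] by auto
  have pos: "d \<ge> 1" "z * w \<ge> 1" using dw u rlz yu assms by (auto simp: Suc_le_eq)
  have "leaf M q (r, r * l, d)"
    using rlz yu dw pos by (auto simp: leaf_def)
  moreover have "leaf_of x (r, r * l, d)"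
    unfolding leaf_of_def prod.case
    using pos(2) rlz yu dw by (intro exI[of _ "z * w"] conjI) (auto simp: prime_dvd_mult_iff not_less)
  ultimately show ?thesis by blast
qed

lemma coprimeI_prime_nat:
  fixes a b :: nat
  assumes "\<And>p. prime p \<Longrightarrow> p dvd a \<Longrightarrow> p dvd b \<Longrightarrow> False"
  shows "coprime a b"
proof (rule ccontr)
  assume "\<not> coprime a b"
  then obtain p where "prime p" "p dvd gcd a b" using prime_factor_nat coprime_iff_gcd_eq_1 by metis
  then show False using assms by auto
qed

text \<open>If r < r', then m' is coprime to d (its primes avoid q), to z (its primes exceed r) and
  to r. As m' divides x = r l d z, it divides l, so m' <= l <= M < m'.\<close>

lemma leaf_mono:
  assumes "M \<ge> 0" and "leaf M q (r, m, d)" "leaf M q (r', m', d')"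
    "leaf_of x (r, m, d)" "leaf_of x (r', m', d')"
  shows "r' \<le> r"
proof (rule ccontr)
  assume "\<not> r' \<le> r"
  then have rr: "r < r'" by simp
  obtain l where l: "m = r * l" "real l \<le> M" and m: "\<forall>p. prime p \<and> p dvd m \<longrightarrow> r \<le> p \<and> \<not> p dvd q"
    and d: "\<forall>p. prime p \<and> p dvd d \<longrightarrow> r < p \<and> p dvd q" and M: "M < real m" and r: "prime r"
    using assms(2) by (auto simp: leaf_def)
  have m': "\<forall>p. prime p \<and> p dvd m' \<longrightarrow> r' \<le> p \<and> \<not> p dvd q" and M': "M < real m'"
    using assms(3) by (auto simp: leaf_def)
  obtain z where z: "x = m * d * z" "\<forall>p. prime p \<and> p dvd z \<longrightarrow> p \<le> r"
    using assms(4) by (auto simp: leaf_of_def)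
  obtain z' where z': "x = m' * d' * z'" using assms(5) by (auto simp: leaf_of_def)
  have "coprime m' d" using m' d by (intro coprimeI_prime_nat) blast
  moreover have "coprime m' z" using m' z rr by (intro coprimeI_prime_nat) (metis not_le le_trans)
  moreover have "coprime m' r" using m' rr r by (intro coprimeI_prime_nat) (metis not_le primes_dvd_imp_eq)
  moreover have "m' dvd r * l * d * z" using z z' l by (metis dvd_triv_left mult.assoc)
  ultimately have "m' dvd l" by (metis coprime_dvd_mult_left_iff coprime_dvd_mult_right_iff)
  moreover have "l > 0" using M l assms(1) by (intro Nat.gr0I) auto
  ultimately have "m' \<le> l" by (simp add: dvd_imp_le)
  then show False using M' l by linarith
qed

text \<open>With r = r' known, d is coprime to m' and z', hence divides d', and conversely. After
  cancelling d, the parts of m and m' prime to r agree because z and z' have no prime above r. The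
  exponent of r is fixed by stopping at the first passage beyond M.\<close>

lemma leaf_unique:
  assumes "M \<ge> 0" and "leaf M q t" "leaf M q t'" "leaf_of x t" "leaf_of x t'"
  shows "t = t'"
proof -
  obtain r m d r' m' d' where t: "t = (r, m, d)" "t' = (r', m', d')" by (cases t, cases t') auto
  have rr: "r' = r" using leaf_mono assms unfolding t by (meson le_antisym)
  obtain l where l: "m = r * l" "real l \<le> M" and m: "\<forall>p. prime p \<and> p dvd m \<longrightarrow> r \<le> p \<and> \<not> p dvd q"
    and d: "\<forall>p. prime p \<and> p dvd d \<longrightarrow> r < p \<and> p dvd q" and M: "M < real m" and r: "prime r" and d1: "d \<ge> 1"
    using assms(2) by (auto simp: leaf_def t)
  obtain l' where l': "m' = r * l'" "real l' \<le> M" and m': "\<forall>p. prime p \<and> p dvd m' \<longrightarrow> r \<le> p \<and> \<not> p dvd q"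
    and d': "\<forall>p. prime p \<and> p dvd d' \<longrightarrow> r < p \<and> p dvd q" and M': "M < real m'" and d1': "d' \<ge> 1"
    using assms(3) by (auto simp: leaf_def t rr)
  obtain z where z: "x = m * d * z" "\<forall>p. prime p \<and> p dvd z \<longrightarrow> p \<le> r"
    using assms(4) by (auto simp: leaf_of_def t)
  obtain z' where z': "x = m' * d' * z'" "\<forall>p. prime p \<and> p dvd z' \<longrightarrow> p \<le> r"
    using assms(5) by (auto simp: leaf_of_def t rr)
  \<comment> \<open>Used twice: for d and d', and later for the parts \<open>b\<close>,
    \<open>b'\<close> of m and m' prime to r, with powers of r in the place of m.\<close>
  have dvd: "d1 dvd d2"
    if "coprime d1 m2" "coprime d1 z2" "m1 * d1 * z1 = m2 * d2 * z2" for d1 d2 m1 m2 z1 z2 :: nat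
    using that by (metis coprime_dvd_mult_left_iff coprime_dvd_mult_right_iff dvd_triv_left dvd_triv_right dvd_mult2 dvd_trans)
  have "coprime d m'" "coprime d' m" using m m' d d' by (intro coprimeI_prime_nat; blast)+
  moreover have "coprime d z'" "coprime d' z" using z z' d d' by (intro coprimeI_prime_nat; metis not_le)+
  moreover have "m * d * z = m' * d' * z'" using z z' by simp
  ultimately have "d dvd d'" "d' dvd d"
    using dvd[of d m' z' m z d'] dvd[of d' m z m' z' d] by auto
  then have dd: "d = d'" by (rule dvd_antisym)
  have mz: "m * z = m' * z'" using z z' dd d1 by (simp add: mult_ac)
  have pos: "m > 0" "m' > 0" using M M' assms(1) by (auto intro!: Nat.gr0I)
  have "\<not> is_unit r" using r by auto
  then obtain b where ab: "m = r ^ multiplicity r m * b" "\<not> r dvd b"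
    using multiplicity_decompose'[of m r] pos by auto
  obtain b' where ab': "m' = r ^ multiplicity r m' * b'" "\<not> r dvd b'"
    using multiplicity_decompose'[of m' r] pos \<open>\<not> is_unit r\<close> by auto
  define i j where "i = multiplicity r m" and "j = multiplicity r m'"
  note ab = ab[folded i_def] and ab' = ab'[folded j_def]
  have rb: "\<forall>p. prime p \<and> p dvd b \<longrightarrow> r < p"  "\<forall>p. prime p \<and> p dvd b' \<longrightarrow> r < p"
    using ab ab' m m' by (metis dvd_mult le_neq_implies_less)+
  have pow: "\<not> r < p" if "prime p" "p dvd r ^ n" for p n
    using that r by (metis prime_dvd_power primes_dvd_imp_eq less_irrefl)
  have "b dvd b'"
    using mz ab ab' rb z' pow
    by (intro dvd[of b "r ^ j" z' "r ^ i" z b'] coprimeI_prime_nat) (auto dest: leD pow simp: mult_ac)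
  moreover have "b' dvd b"
    using mz ab ab' rb z pow
    by (intro dvd[of b' "r ^ i" z "r ^ j" z' b] coprimeI_prime_nat) (auto dest: leD pow simp: mult_ac)
  ultimately have bb: "b = b'" by (rule dvd_antisym)
  \<comment> \<open>If r occurred more often in m' than in m, then l' would be a multiple of m and
    hence exceed M.\<close>
  have le: "j \<le> i" if "m = r ^ i * b" "m' = r ^ j * b" "m' = r * l'" "real l' \<le> M" "M < real m" for i j m m' l'
  proof (rule ccontr)
    assume "\<not> j \<le> i"
    then obtain c where "j = Suc (i + c)" by (metis not_le less_imp_Suc_add)
    then have "r * l' = r * (m * r ^ c)" using that by (simp add: power_add mult_ac)
    then have "l' = m * r ^ c" using prime_gt_0_nat[OF r] by simp
    then have "m \<le> l'" using prime_gt_0_nat[OF r] by simp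
    then show False using that by linarith
  qed
  have "i = j" using le[of m i m' j l'] le[of m' j m i l] ab ab' bb l l' M M' by (intro le_antisym) auto
  then show ?thesis using t rr dd ab ab' bb by simp
qed

text \<open>Size conditions only, so that this finite set is independent of q and its sum can be
  exchanged with the sum over arcs. The upper bound for m reflects m = r l with l <= M and r <=
  R.\<close>

definition triples :: "real \<Rightarrow> real \<Rightarrow> real \<Rightarrow> (nat \<times> nat \<times> nat) set" where
  "triples M P R = {(r, m, d). 1 \<le> r \<and> real r \<le> R \<and> M < real m \<and> real m \<le> M * R \<and> 1 \<le> d \<and> real (m * d) \<le> P}"

definition triples_for :: "real \<Rightarrow> real \<Rightarrow> real \<Rightarrow> nat \<Rightarrow> (nat \<times> nat \<times> nat) set" where
  "triples_for M P R q = {(r, m, d) \<in> triples M P R. coprime m q \<and> d \<in> prime_supported (prime_factors q) (nat \<lfloor>P\<rfloor>)}"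

lemma triples_subset:
  assumes "M \<ge> 1"
  shows "triples M P R \<subseteq> {1..nat \<lfloor>R\<rfloor>} \<times> {1..nat \<lfloor>M * R\<rfloor>} \<times> {1..nat \<lfloor>P\<rfloor>}"
proof
  fix t assume "t \<in> triples M P R"
  then obtain r m d where t: "t = (r, m, d)" "1 \<le> r" "real r \<le> R" "M < real m" "real m \<le> M * R" "1 \<le> d"
    "real (m * d) \<le> P" by (auto simp: triples_def)
  have m: "1 \<le> m" using t assms by linarith
  then have "real (1 * d) \<le> real (m * d)" by (intro of_nat_mono mult_right_mono) auto
  then have "real d \<le> P" using t by linarith
  then show "t \<in> {1..nat \<lfloor>R\<rfloor>} \<times> {1..nat \<lfloor>M * R\<rfloor>} \<times> {1..nat \<lfloor>P\<rfloor>}"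
    using t m by (auto simp: le_nat_floor)
qed

lemma finite_triples: "M \<ge> 1 \<Longrightarrow> finite (triples M P R)"
  by (rule finite_subset[OF triples_subset]) auto

lemma finite_triples_for: "M \<ge> 1 \<Longrightarrow> finite (triples_for M P R q)"
  by (rule finite_subset[OF _ finite_triples[of M P R]]) (auto simp: triples_for_def)

lemma card_triples_for_le:
  assumes "M \<ge> 1" "R \<ge> 1"
  shows "real (card (triples_for M P R q)) \<le> R * (M * R) * real (card (prime_supported (prime_factors q) (nat \<lfloor>P\<rfloor>)))"
proof -
  let ?S = "prime_supported (prime_factors q) (nat \<lfloor>P\<rfloor>)"
  have "triples_for M P R q \<subseteq> {1..nat \<lfloor>R\<rfloor>} \<times> {1..nat \<lfloor>M * R\<rfloor>} \<times> ?S"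
    using triples_subset[OF assms(1), of P R] by (auto simp: triples_for_def)
  then have "card (triples_for M P R q) \<le> card ({1..nat \<lfloor>R\<rfloor>} \<times> {1..nat \<lfloor>M * R\<rfloor>} \<times> ?S)"
    by (intro card_mono) auto
  then have "real (card (triples_for M P R q)) \<le> real (nat \<lfloor>R\<rfloor>) * (real (nat \<lfloor>M * R\<rfloor>) * real (card ?S))"
    by (simp add: card_cartesian_product flip: of_nat_mult)
  also have "\<dots> \<le> R * ((M * R) * real (card ?S))"
    using assms by (intro mult_mono) auto
  finally show ?thesis by (simp add: mult_ac)
qed

text \<open>An x without leaf has the form y u with y <= M and u built from primes of q, which gives
  the first term. The other x are grouped by their unique leaf; a nonempty group consists of all m d
  z with z r-smooth and at most P/(m d), so a complete Weyl sum appears, at \<alpha> (m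
  d)^k.\<close>

lemma norm_weyl_f_le_sum:
  assumes "M \<ge> 1" "P \<ge> 1" "R \<ge> 1" "q \<ge> 1"
  shows "cmod (weyl_f k \<alpha> P R) \<le> M * real (card (prime_supported (prime_factors q) (nat \<lfloor>P\<rfloor>)))
     + (\<Sum>(r, m, d)\<in>triples_for M P R q.
          cmod (weyl_f k (real (d ^ k) * (real (m ^ k) * \<alpha>)) (P / real (m * d)) (real r)))"
proof -
  let ?S = "prime_supported (prime_factors q) (nat \<lfloor>P\<rfloor>)"
  let ?A = "smooth_set P R"
  let ?f = "\<lambda>x. e (\<alpha> * real x ^ k)"
  let ?g = "\<lambda>(r, m, d). cmod (weyl_f k (real (d ^ k) * (real (m ^ k) * \<alpha>)) (P / real (m * d)) (real r))"
  define L where "L = {x \<in> ?A. \<exists>t. leaf M q t \<and> leaf_of x t}"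
  define \<tau> where "\<tau> x = (SOME t. leaf M q t \<and> leaf_of x t)" for x
  have L: "L \<subseteq> ?A" "finite L" unfolding L_def by auto
  have \<tau>: "leaf M q (\<tau> x) \<and> leaf_of x (\<tau> x)" if "x \<in> L" for x
    unfolding \<tau>_def by (rule someI_ex) (use that L_def in auto)
  have "real (card (?A - L)) \<le> M * real (card ?S)"
  proof -
    have "?A - L \<subseteq> (\<lambda>(y, u). y * u) ` ({1..nat \<lfloor>M\<rfloor>} \<times> ?S)"
    proof
      fix x assume x: "x \<in> ?A - L"
      then have x1: "x \<ge> 1" "real x \<le> P" by (auto simp: smooth_set_def)
      have "\<nexists>t. leaf M q t \<and> leaf_of x t" using x L_def by auto
      with exists_leaf[OF assms(1,4) x1(1)] obtain y u where yu: "x = y * u" "real y \<le> M"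
        "\<forall>p. prime p \<and> p dvd u \<longrightarrow> p dvd q" by metis
      have pos: "y \<ge> 1" "u \<ge> 1" using x1 yu by (auto simp: Suc_le_eq)
      have "real u \<le> real (y * u)" using pos by (intro of_nat_mono) simp
      then have "real u \<le> P" using x1(2) unfolding yu(1) by linarith
      then have "u \<in> ?S" using yu pos assms(4) by (auto simp: prime_supported_def le_nat_floor prime_factors_dvd)
      then show "x \<in> (\<lambda>(y, u). y * u) ` ({1..nat \<lfloor>M\<rfloor>} \<times> ?S)"
        using yu pos by (auto simp: le_nat_floor intro!: image_eqI[of _ _ "(y, u)"])
    qed
    then have "card (?A - L) \<le> card ((\<lambda>(y, u). y * u) ` ({1..nat \<lfloor>M\<rfloor>} \<times> ?S))"
      by (intro card_mono) auto
    also have "\<dots> \<le> card ({1..nat \<lfloor>M\<rfloor>} \<times> ?S)" by (intro card_image_le) auto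
    finally have "real (card (?A - L)) \<le> real (nat \<lfloor>M\<rfloor>) * real (card ?S)"
      by (simp add: card_cartesian_product flip: of_nat_mult)
    also have "\<dots> \<le> M * real (card ?S)" using assms by (intro mult_right_mono) auto
    finally show ?thesis .
  qed
  moreover have "cmod (\<Sum>x\<in>?A - L. ?f x) \<le> real (card (?A - L))"
    using norm_sum[of ?f "?A - L"] by simp
  moreover have "cmod (\<Sum>x\<in>L. ?f x) \<le> (\<Sum>t\<in>triples_for M P R q. ?g t)"
  proof -
    have fib: "t \<in> triples_for M P R q \<and> cmod (\<Sum>x\<in>{x\<in>L. \<tau> x = t}. ?f x) = ?g t" if t_in: "t \<in> \<tau> ` L" for t
    proof -
      obtain x0 where x0: "x0 \<in> L" "\<tau> x0 = t" using t_in by auto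
      obtain r m d where t: "t = (r, m, d)" by (cases t) auto
      have lf: "leaf M q (r, m, d)" "leaf_of x0 (r, m, d)" using \<tau>[OF x0(1)] x0 t by auto
      obtain z0 where z0: "z0 \<ge> 1" "x0 = m * d * z0" using lf(2) by (auto simp: leaf_of_def)
      have x0A: "1 \<le> x0" "real x0 \<le> P" "\<And>p. prime p \<Longrightarrow> p dvd x0 \<Longrightarrow> real p \<le> R"
        using x0 L by (auto simp: smooth_set_def)
      obtain l where l: "m = r * l" "real l \<le> M" "prime r" "M < real m"
         "\<forall>p. prime p \<and> p dvd m \<longrightarrow> r \<le> p \<and> \<not> p dvd q" "d \<ge> 1" "\<forall>p. prime p \<and> p dvd d \<longrightarrow> r < p \<and> p dvd q"
        using lf(1) by (auto simp: leaf_def)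
      have m1: "m \<ge> 1" using x0A z0 by (auto simp: Suc_le_eq)
      have rR: "real r \<le> R" using x0A(3)[of r] l z0 by auto
      have mR: "real m \<le> M * R" using mult_mono[OF l(2) rR] l(1) assms by (simp add: mult.commute)
      have "real (m * d) \<le> real (m * d * z0)" using z0(1) by (intro of_nat_mono) simp
      then have mdP: "real (m * d) \<le> P" using x0A(2) unfolding z0(2) by linarith
      have "real d \<le> real (m * d)" using m1 by (intro of_nat_mono) simp
      then have dP: "real d \<le> P" using mdP by linarith
      have "t \<in> triples M P R"
        unfolding t triples_def using rR mR mdP l prime_ge_1_nat[OF l(3)] by simp
      moreover have "coprime m q" using l by (intro coprimeI_prime_nat) blast
      moreover have "d \<in> ?S" using l dP assms(4) by (auto simp: prime_supported_def le_nat_floor prime_factors_dvd)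
      ultimately have tt: "t \<in> triples_for M P R q" by (simp add: triples_for_def t)
      have md: "m * d > 0" using m1 l by simp
      \<comment> \<open>The witness \<open>x0\<close> shows that all primes of m d are at most R.
        Together with r <= R this puts every such product m d z into \<open>?A\<close>, and
        uniqueness of leaves puts it into this fibre.\<close>
      have "{x\<in>L. \<tau> x = t} = (\<lambda>z. m * d * z) ` smooth_set (P / real (m * d)) (real r)"
      proof (intro equalityI subsetI)
        fix x assume "x \<in> {x\<in>L. \<tau> x = t}"
        then have x: "x \<in> L" "leaf_of x (r, m, d)" using \<tau>[of x] t by auto
        then obtain z where z: "z \<ge> 1" "x = m * d * z" "\<forall>p. prime p \<and> p dvd z \<longrightarrow> p \<le> r"
          by (auto simp: leaf_of_def)
        have "real (m * d * z) \<le> P" using x z L by (auto simp: smooth_set_def)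
        then have "real z \<le> P / real (m * d)" using md by (simp add: field_simps)
        then have "z \<in> smooth_set (P / real (m * d)) (real r)" using z by (auto simp: smooth_set_def)
        then show "x \<in> (\<lambda>z. m * d * z) ` smooth_set (P / real (m * d)) (real r)" using z by auto
      next
        fix x assume "x \<in> (\<lambda>z. m * d * z) ` smooth_set (P / real (m * d)) (real r)"
        then obtain z where z: "x = m * d * z" "z \<ge> 1" "real z \<le> P / real (m * d)"
           "\<forall>p. prime p \<and> p dvd z \<longrightarrow> p \<le> r" by (auto simp: smooth_set_def)
        have xP: "real x \<le> P" using z md by (simp add: field_simps)
        have x1: "x \<ge> 1" using z md by (simp add: Suc_le_eq)
        have "real p \<le> R" if p: "prime p" "p dvd x" for p
        proof -
          consider "p dvd m * d" | "p dvd z" using p z by (auto simp: prime_dvd_mult_iff)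
          then show ?thesis
          proof cases
            case 1 then show ?thesis using x0A(3)[OF p(1)] z0 by auto
          next
            case 2 then have "p \<le> r" using z p by auto
            then show ?thesis using rR by linarith
          qed
        qed
        then have xA: "x \<in> ?A" using xP x1 by (auto simp: smooth_set_def)
        have lx: "leaf_of x (r, m, d)" using z by (auto simp: leaf_of_def)
        then have xL: "x \<in> L" using xA lf by (auto simp: L_def)
        have "\<tau> x = t" using assms(1) leaf_unique[of M q "\<tau> x" t x] \<tau>[OF xL] lx lf t by auto
        then show "x \<in> {x\<in>L. \<tau> x = t}" using xL by auto
      qed
      moreover have "inj_on (\<lambda>z. m * d * z) (smooth_set (P / real (m * d)) (real r))"
        using md by (intro inj_onI) auto
      ultimately have "(\<Sum>x\<in>{x\<in>L. \<tau> x = t}. ?f x) =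
          (\<Sum>z\<in>smooth_set (P / real (m * d)) (real r). ?f (m * d * z))"
        by (simp add: sum.reindex o_def)
      also have "\<dots> = weyl_f k (real (d ^ k) * (real (m ^ k) * \<alpha>)) (P / real (m * d)) (real r)"
        unfolding weyl_f_def by (intro sum.cong refl) (simp add: power_mult_distrib mult_ac)
      finally show ?thesis using tt t by simp
    qed
    have "cmod (\<Sum>x\<in>L. ?f x) = cmod (\<Sum>t\<in>\<tau> ` L. \<Sum>x\<in>{x\<in>L. \<tau> x = t}. ?f x)"
      by (subst sum.image_gen[OF L(2), of _ \<tau>]) simp
    also have "\<dots> \<le> (\<Sum>t\<in>\<tau> ` L. cmod (\<Sum>x\<in>{x\<in>L. \<tau> x = t}. ?f x))" by (rule norm_sum)
    also have "\<dots> = (\<Sum>t\<in>\<tau> ` L. ?g t)" using fib by (intro sum.cong) auto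
    \<comment> \<open>Triples that are the chosen leaf of no x only enlarge the sum.\<close>
    also have "\<dots> \<le> (\<Sum>t\<in>triples_for M P R q. ?g t)"
      using fib finite_triples_for[OF assms(1)] by (intro sum_mono2) (auto split: prod.splits)
    finally show ?thesis .
  qed
  moreover have "weyl_f k \<alpha> P R = (\<Sum>x\<in>?A - L. ?f x) + (\<Sum>x\<in>L. ?f x)"
    unfolding weyl_f_def using sum.subset_diff[OF L(1), of ?f] by simp
  ultimately show ?thesis
    using norm_triangle_ineq[of "\<Sum>x\<in>?A - L. ?f x" "\<Sum>x\<in>L. ?f x"] by simp
qed

section \<open>Diophantine approximations and periodic integrands\<close>

text \<open>Pigeonhole: a cell of length \<rho>, closed on the left only, contains at most one of
  the points.\<close>

lemma card_separated_le:
  fixes g :: "'a \<Rightarrow> real"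
  assumes "finite A" "\<rho> > 0" "L \<ge> 0"
    and "\<And>x. x \<in> A \<Longrightarrow> u \<le> g x \<and> g x \<le> u + L"
    and "\<And>x y. x \<in> A \<Longrightarrow> y \<in> A \<Longrightarrow> x \<noteq> y \<Longrightarrow> \<bar>g x - g y\<bar> \<ge> \<rho>"
  shows "real (card A) \<le> 1 + L / \<rho>"
proof -
  let ?f = "\<lambda>x. \<lfloor>(g x - u) / \<rho>\<rfloor>"
  have "inj_on ?f A"
  proof (rule inj_onI, rule ccontr)
    fix x y assume xy: "x \<in> A" "y \<in> A" "?f x = ?f y" "x \<noteq> y"
    have "\<bar>(g x - u) / \<rho> - (g y - u) / \<rho>\<bar> < 1" using xy(3) by linarith
    moreover have "(g x - u) / \<rho> - (g y - u) / \<rho> = (g x - g y) / \<rho>" by (simp add: diff_divide_distrib)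
    ultimately have "\<bar>g x - g y\<bar> < \<rho>" using assms(2) by simp
    then show False using assms(5)[OF xy(1,2,4)] by linarith
  qed
  then have "card A = card (?f ` A)" by (simp add: card_image)
  also have "\<dots> \<le> card {0..\<lfloor>L / \<rho>\<rfloor>}"
  proof (intro card_mono image_subsetI)
    fix x assume "x \<in> A"
    then have "0 \<le> (g x - u) / \<rho>" "(g x - u) / \<rho> \<le> L / \<rho>"
      using assms(2) assms(4)[of x] by (auto intro!: divide_right_mono)
    then show "?f x \<in> {0..\<lfloor>L / \<rho>\<rfloor>}" by (auto intro: floor_mono)
  qed auto
  finally have "real (card A) \<le> real (nat (\<lfloor>L / \<rho>\<rfloor> + 1))" by simp
  also have "\<dots> = of_int \<lfloor>L / \<rho>\<rfloor> + 1" using assms by (subst of_nat_nat) auto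
  also have "\<dots> \<le> 1 + L / \<rho>" by linarith
  finally show ?thesis .
qed

lemma coprime_fraction_gap:
  fixes q q' b b' :: int
  assumes "q > 0" "q' > 0" "coprime b q" "coprime b' q'" "(q, b) \<noteq> (q', b')"
  shows "\<bar>b / q - b' / q'\<bar> \<ge> 1 / (real_of_int q * real_of_int q')"
proof -
  have "b * q' \<noteq> b' * q"
  proof
    assume eq: "b * q' = b' * q"
    have "q dvd b * q'" "q' dvd b' * q" using eq by (metis dvd_triv_right)+
    then have "q dvd q'" "q' dvd q"
      using assms(3,4) by (auto simp: coprime_dvd_mult_right_iff coprime_commute)
    then have "q = q'" using assms(1,2) by (auto intro: zdvd_antisym_nonneg)
    then show False using eq assms by auto
  qed
  then have "1 \<le> \<bar>real_of_int (b * q' - b' * q)\<bar>" by linarith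
  moreover have "b / q - b' / q' = real_of_int (b * q' - b' * q) / (real_of_int q * real_of_int q')"
    using assms by (simp add: field_simps)
  ultimately show ?thesis using assms by (simp add: abs_mult divide_right_mono)
qed

text \<open>The reduced fractions b/q whose arc of half-width \<theta>/q contains \<gamma>. With
  \<theta> the dilated width, their number controls how often the dilated arcs cover
  \<gamma>.\<close>

definition approx_pairs :: "real \<Rightarrow> real \<Rightarrow> real \<Rightarrow> (int \<times> int) set" where
  "approx_pairs Q \<theta> \<gamma> = {(q, b). 1 \<le> q \<and> real_of_int q \<le> Q \<and> coprime b q \<and> \<bar>real_of_int q * \<gamma> - real_of_int b\<bar> \<le> \<theta>}"

lemma finite_approx_pairs: "finite (approx_pairs Q \<theta> \<gamma>)"
proof (rule finite_subset)
  show "approx_pairs Q \<theta> \<gamma> \<subseteq> (SIGMA q:{1..\<lfloor>Q\<rfloor>}. {\<lfloor>q * \<gamma> - \<theta>\<rfloor>..\<lceil>q * \<gamma> + \<theta>\<rceil>})"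
    by (auto simp: approx_pairs_def le_floor_iff) linarith+
qed auto

text \<open>Within a dyadic range of denominators, distinct reduced fractions are at least $4^{-j-1}$ apart.\<close>

lemma card_dyadic_approx_pairs:
  assumes "\<theta> \<ge> 0"
  shows "real (card {(q, b) \<in> approx_pairs Q \<theta> \<gamma>. 2 ^ j \<le> q \<and> q < 2 ^ Suc j}) \<le> 1 + 8 * 2 ^ j * \<theta>"
proof -
  let ?A = "{(q, b) \<in> approx_pairs Q \<theta> \<gamma>. 2 ^ j \<le> q \<and> q < 2 ^ Suc j}"
  \<comment> \<open>All fractions lie within \<theta>/2^j of \<gamma>; the interval has length 2
    \<theta>/2^j, and dividing by the gap gives 8 2^j \<theta>.\<close>
  have "real (card ?A) \<le> 1 + (2 * \<theta> / 2 ^ j) / (1 / (2 ^ Suc j * 2 ^ Suc j))"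
  proof (rule card_separated_le[where g = "\<lambda>(q, b). real_of_int b / real_of_int q" and u = "\<gamma> - \<theta> / 2 ^ j"])
    show "finite ?A" by (rule finite_subset[OF _ finite_approx_pairs]) auto
    fix x assume "x \<in> ?A"
    then obtain q b where x: "x = (q, b)" "1 \<le> q" "\<bar>real_of_int q * \<gamma> - real_of_int b\<bar> \<le> \<theta>" "2 ^ j \<le> q"
      by (auto simp: approx_pairs_def)
    have q: "real_of_int q > 0" "2 ^ j \<le> real_of_int q" using x
      by (simp, metis of_int_le_iff of_int_power of_int_numeral)
    have "\<gamma> - b / q = (real_of_int q * \<gamma> - real_of_int b) / q"
      using q by (simp add: field_simps)
    then have "\<bar>\<gamma> - b / q\<bar> = \<bar>real_of_int q * \<gamma> - real_of_int b\<bar> / q"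
      using q by simp
    also have "\<dots> \<le> \<theta> / 2 ^ j" using x q assms by (intro frac_le) auto
    finally show "\<gamma> - \<theta> / 2 ^ j \<le> (case x of (q, b) \<Rightarrow> real_of_int b / real_of_int q) \<and>
       (case x of (q, b) \<Rightarrow> real_of_int b / real_of_int q) \<le> \<gamma> - \<theta> / 2 ^ j + 2 * \<theta> / 2 ^ j"
      by (simp add: x) linarith
  next
    fix x y assume xy: "x \<in> ?A" "y \<in> ?A" "x \<noteq> y"
    then obtain q b q' b' where x: "x = (q, b)" "1 \<le> q" "q < 2 ^ Suc j" "coprime b q"
       and y: "y = (q', b')" "1 \<le> q'" "q' < 2 ^ Suc j" "coprime b' q'"
      by (auto simp: approx_pairs_def)
    have "real_of_int q < real_of_int (2 ^ Suc j)" "real_of_int q' < real_of_int (2 ^ Suc j)"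
      using x y by (simp_all only: of_int_less_iff)
    then have "1 / (2 ^ Suc j * 2 ^ Suc j) \<le> 1 / (real_of_int q * real_of_int q')"
      using x y by (intro divide_left_mono mult_mono mult_pos_pos) auto
    also have "\<dots> \<le> \<bar>b / q - b' / q'\<bar>" using x y xy by (intro coprime_fraction_gap) auto
    finally show "1 / (2 ^ Suc j * 2 ^ Suc j) \<le> \<bar>(case x of (q, b) \<Rightarrow> real_of_int b / real_of_int q) -
        (case y of (q, b) \<Rightarrow> real_of_int b / real_of_int q)\<bar>" by (simp add: x y)
  qed (use assms in auto)
  also have "\<dots> = 1 + 8 * 2 ^ j * \<theta>" by simp
  finally show ?thesis .
qed

text \<open>The dyadic splitting makes the bound linear in Q, up to the logarithm. Treating all q at
  once would pair the interval of length 2 \<theta> that belongs to q = 1 with the gap Q^(-2) of the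
  largest denominators, for a bound of order Q^2 \<theta>.\<close>

lemma card_approx_pairs_le:
  assumes "\<theta> \<ge> 0" "Q \<ge> 1"
  shows "real (card (approx_pairs Q \<theta> \<gamma>)) \<le> (1 + log 2 Q) * (1 + 8 * Q * \<theta>)"
proof -
  define J where "J = nat \<lfloor>log 2 Q\<rfloor>"
  let ?A = "\<lambda>j. {(q, b) \<in> approx_pairs Q \<theta> \<gamma>. 2 ^ j \<le> q \<and> q < 2 ^ Suc j}"
  have lg: "log 2 Q \<ge> 0" using assms by simp
  have J: "real J \<le> log 2 Q" using lg by (simp add: J_def)
  have "approx_pairs Q \<theta> \<gamma> \<subseteq> (\<Union>j\<in>{..J}. ?A j)"
  proof
    fix x assume x: "x \<in> approx_pairs Q \<theta> \<gamma>"
    obtain q b where qb: "x = (q, b)" by (cases x)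
    have q: "1 \<le> q" "real_of_int q \<le> Q" using x qb by (auto simp: approx_pairs_def)
    have "1 \<le> nat q" using q by simp
    from ex_power_ivl1[OF order_refl this] obtain j where j: "2 ^ j \<le> nat q" "nat q < 2 ^ (j + 1)" by blast
    have jq: "2 ^ j \<le> q" "q < 2 ^ Suc j"
      using j q by (simp_all add: le_nat_iff nat_less_iff)
    have "2 ^ j \<le> real_of_int q" using jq(1) by (metis of_int_le_iff of_int_power of_int_numeral)
    then have "2 powr real j \<le> Q" using q(2) unfolding powr_realpow[OF zero_less_numeral] by linarith
    then have "real j \<le> log 2 Q" using assms by (simp add: le_log_iff)
    then have "j \<le> J" by (simp add: J_def le_nat_floor)
    then show "x \<in> (\<Union>j\<in>{..J}. ?A j)" using x qb jq by auto
  qed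
  then have "card (approx_pairs Q \<theta> \<gamma>) \<le> card (\<Union>j\<in>{..J}. ?A j)"
    by (intro card_mono finite_UN_I finite_subset[OF _ finite_approx_pairs[of Q \<theta> \<gamma>]]) auto
  also have "\<dots> \<le> (\<Sum>j\<le>J. card (?A j))" by (rule card_UN_le) simp
  finally have "real (card (approx_pairs Q \<theta> \<gamma>)) \<le> (\<Sum>j\<le>J. real (card (?A j)))"
    by (simp flip: of_nat_sum)
  also have "\<dots> \<le> (\<Sum>j\<le>J. 1 + 8 * Q * \<theta>)"
  proof (intro sum_mono)
    fix j assume "j \<in> {..J}"
    then have "real j \<le> log 2 Q" using J by auto
    then have "2 ^ j \<le> Q" using assms by (simp add: le_log_iff powr_realpow)
    then have "1 + 8 * 2 ^ j * \<theta> \<le> 1 + 8 * Q * \<theta>" using assms by (simp add: mult_right_mono)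
    then show "real (card (?A j)) \<le> 1 + 8 * Q * \<theta>"
      using card_dyadic_approx_pairs[OF assms(1), of Q \<gamma> j] by linarith
  qed
  also have "\<dots> = (real J + 1) * (1 + 8 * Q * \<theta>)" by simp
  also have "\<dots> \<le> (1 + log 2 Q) * (1 + 8 * Q * \<theta>)" using J assms by (intro mult_right_mono) auto
  finally show ?thesis .
qed

text \<open>Substitute y = n x, cut the line at the integers and shift each piece back to [0, 1) by
  periodicity. The left side becomes 1/n times the integral of G over [0, 1), weighted by the number
  of pairs (i, h) with (x + h)/n in \<open>B i\<close>. The bound \<open>H\<close> makes the range
  of the shifts finite.\<close>

lemma periodic_unfold_le:
  fixes G :: "real \<Rightarrow> ennreal" and B :: "'i \<Rightarrow> real set" and H :: int
  assumes G [measurable]: "G \<in> borel_measurable borel"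
    and per: "\<And>x h. G (x + of_int h) = G x"
    and n: "n > 0" and I: "finite I" and B [measurable]: "\<And>i. B i \<in> sets borel"
    and H: "\<And>i x. i \<in> I \<Longrightarrow> x \<in> B i \<Longrightarrow> - of_int H \<le> n * x \<and> n * x < of_int H"
    and K: "\<And>\<gamma>. 0 \<le> \<gamma> \<Longrightarrow> \<gamma> < 1 \<Longrightarrow>
      real (card {(i, h). i \<in> I \<and> h \<in> {-H..<H} \<and> (\<gamma> + of_int h) / n \<in> B i}) \<le> K"
  shows "(\<Sum>i\<in>I. \<integral>\<^sup>+x. G (n * x) * indicator (B i) x \<partial>lborel)
           \<le> ennreal (K / n) * (\<integral>\<^sup>+x. G x * indicator {0..<1} x \<partial>lborel)"
proof -
  let ?F = "\<lambda>i y. G y * indicator (B i) (y / n)"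
  let ?J = "{-H..<H}"
  have scale: "ennreal n * (\<integral>\<^sup>+x. G (n * x) * indicator (B i) x \<partial>lborel) = (\<integral>\<^sup>+y. ?F i y \<partial>lborel)" for i
    using nn_integral_real_affine[of "?F i" n 0] n by simp
  have split: "(\<integral>\<^sup>+y. ?F i y \<partial>lborel) = (\<Sum>h\<in>?J. \<integral>\<^sup>+x. G x * indicator (B i) ((x + of_int h) / n) * indicator {0..<1} x \<partial>lborel)"
    if i: "i \<in> I" for i
  proof -
    \<comment> \<open>Only h = floor of y can give a nonzero term, and \<open>H\<close> guarantees
      that it lies in \<open>?J\<close>.\<close>
    have "?F i y = (\<Sum>h\<in>?J. ?F i y * indicator {of_int h..<of_int h + 1} y)" for y
    proof (cases "y / n \<in> B i")
      case True
      then have "- of_int H \<le> y" "y < of_int H" using H[OF i True] n by auto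
      then have fl: "\<lfloor>y\<rfloor> \<in> ?J" by (auto simp: le_floor_iff floor_less_iff)
      have "(\<Sum>h\<in>?J. ?F i y * indicator {of_int h..<of_int h + 1} y)
           = (\<Sum>h\<in>?J. if h = \<lfloor>y\<rfloor> then ?F i y else 0)"
      proof (intro sum.cong refl)
        fix h :: int
        have "y \<in> {of_int h..<of_int h + 1} \<longleftrightarrow> h = \<lfloor>y\<rfloor>" by (auto simp: floor_eq_iff eq_commute[of h])
        then show "?F i y * indicator {of_int h..<of_int h + 1} y = (if h = \<lfloor>y\<rfloor> then ?F i y else 0)"
          by (simp add: indicator_def)
      qed
      also have "\<dots> = ?F i y" using fl by simp
      finally show ?thesis by simp
    qed simp
    then have "(\<integral>\<^sup>+y. ?F i y \<partial>lborel) = (\<integral>\<^sup>+y. (\<Sum>h\<in>?J. ?F i y * indicator {of_int h..<of_int h + 1} y) \<partial>lborel)"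
      by (rule arg_cong[where f = "integral\<^sup>N lborel", OF ext])
    also have "\<dots> = (\<Sum>h\<in>?J. \<integral>\<^sup>+y. ?F i y * indicator {of_int h..<of_int h + 1} y \<partial>lborel)"
      by (intro nn_integral_sum) measurable
    also have "\<dots> = (\<Sum>h\<in>?J. \<integral>\<^sup>+x. G x * indicator (B i) ((x + of_int h) / n) * indicator {0..<1} x \<partial>lborel)"
    proof (intro sum.cong refl)
      fix h :: int
      have "(\<integral>\<^sup>+y. ?F i y * indicator {of_int h..<of_int h + 1} y \<partial>lborel)
         = (\<integral>\<^sup>+x. ?F i (of_int h + 1 * x) * indicator {of_int h..<of_int h + 1} (of_int h + 1 * x) \<partial>lborel)"
        by (subst nn_integral_real_affine[where c = 1 and t = "of_int h"]) auto
      also have "\<dots> = (\<integral>\<^sup>+x. G x * indicator (B i) ((x + of_int h) / n) * indicator {0..<1} x \<partial>lborel)"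
        using per by (intro nn_integral_cong) (auto simp: indicator_def add.commute)
      finally show "(\<integral>\<^sup>+y. ?F i y * indicator {of_int h..<of_int h + 1} y \<partial>lborel)
         = (\<integral>\<^sup>+x. G x * indicator (B i) ((x + of_int h) / n) * indicator {0..<1} x \<partial>lborel)" .
    qed
    finally show ?thesis .
  qed
  have "ennreal n * (\<Sum>i\<in>I. \<integral>\<^sup>+x. G (n * x) * indicator (B i) x \<partial>lborel)
     = (\<Sum>i\<in>I. \<Sum>h\<in>?J. \<integral>\<^sup>+x. G x * indicator (B i) ((x + of_int h) / n) * indicator {0..<1} x \<partial>lborel)"
    using split by (simp add: sum_distrib_left scale)
  also have "\<dots> = (\<integral>\<^sup>+x. (\<Sum>i\<in>I. \<Sum>h\<in>?J. G x * indicator (B i) ((x + of_int h) / n) * indicator {0..<1} x) \<partial>lborel)"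
    by (subst nn_integral_sum, measurable, intro sum.cong refl nn_integral_sum[symmetric]) measurable
  also have "\<dots> \<le> (\<integral>\<^sup>+x. ennreal K * (G x * indicator {0..<1} x) \<partial>lborel)"
  proof (intro nn_integral_mono)
    fix x :: real
    show "(\<Sum>i\<in>I. \<Sum>h\<in>?J. G x * indicator (B i) ((x + of_int h) / n) * indicator {0..<1} x)
            \<le> ennreal K * (G x * indicator {0..<1} x)"
    proof (cases "x \<in> {0..<1}")
      case True
      let ?S = "{(i, h). i \<in> I \<and> h \<in> ?J \<and> (x + of_int h) / n \<in> B i}"
      have "(\<Sum>i\<in>I. \<Sum>h\<in>?J. indicator (B i) ((x + of_int h) / n) :: ennreal)
         = (\<Sum>t\<in>I \<times> ?J. indicator ?S t)"
        unfolding sum.cartesian_product by (intro sum.cong) (auto simp: indicator_def)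
      also have "\<dots> = of_nat (card ((I \<times> ?J) \<inter> ?S))"
        using I unfolding indicator_def by (subst sum_of_bool_eq) (auto simp only: finite_cartesian_product finite_atLeastLessThan_int Collect_mem_eq)
      also have "(I \<times> ?J) \<inter> ?S = ?S" by auto
      also have "of_nat (card ?S) = ennreal (real (card ?S))" by (simp add: ennreal_of_nat_eq_real_of_nat)
      also have "\<dots> \<le> ennreal K" using K[of x] True by (intro ennreal_leI) auto
      finally have "(\<Sum>i\<in>I. \<Sum>h\<in>?J. indicator (B i) ((x + of_int h) / n) :: ennreal) \<le> ennreal K" .
      then have "G x * (\<Sum>i\<in>I. \<Sum>h\<in>?J. indicator (B i) ((x + of_int h) / n)) \<le> G x * ennreal K"
        by (rule mult_left_mono) simp
      moreover have "indicator {0..<1} x = (1 :: ennreal)" using True by simp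
      ultimately show ?thesis by (simp only: mult_1_right sum_distrib_left mult.commute[of "ennreal K"])
    qed simp
  qed
  also have "\<dots> = ennreal K * (\<integral>\<^sup>+x. G x * indicator {0..<1} x \<partial>lborel)"
    by (rule nn_integral_cmult) measurable
  finally have *: "ennreal n * (\<Sum>i\<in>I. \<integral>\<^sup>+x. G (n * x) * indicator (B i) x \<partial>lborel)
     \<le> ennreal K * (\<integral>\<^sup>+x. G x * indicator {0..<1} x \<partial>lborel)" .
  have K0: "K \<ge> 0" using K[of 0] by (meson of_nat_0_le_iff order_trans zero_less_one order_refl)
  have "(\<Sum>i\<in>I. \<integral>\<^sup>+x. G (n * x) * indicator (B i) x \<partial>lborel)
     = ennreal (1 / n) * (ennreal n * (\<Sum>i\<in>I. \<integral>\<^sup>+x. G (n * x) * indicator (B i) x \<partial>lborel))"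
    using n by (simp add: mult.assoc[symmetric] ennreal_mult[symmetric])
  also have "\<dots> \<le> ennreal (1 / n) * (ennreal K * (\<integral>\<^sup>+x. G x * indicator {0..<1} x \<partial>lborel))"
    using * by (rule mult_left_mono) simp
  also have "\<dots> = ennreal (K / n) * (\<integral>\<^sup>+x. G x * indicator {0..<1} x \<partial>lborel)"
    using n K0 by (simp add: mult.assoc[symmetric] ennreal_mult[symmetric])
  finally show ?thesis .
qed

text \<open>Unfolding with the single set [0, 1): a point \<gamma> has at most D preimages (\<gamma>
  + h)/D there, which cancels the factor 1/D of the substitution.\<close>

lemma periodic_dilation_le:
  fixes G :: "real \<Rightarrow> ennreal" and D :: nat
  assumes [measurable]: "G \<in> borel_measurable borel"
    and per: "\<And>x h. G (x + of_int h) = G x" and D: "D \<ge> 1"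
  shows "(\<integral>\<^sup>+x. G (real D * x) * indicator {0..<1} x \<partial>lborel) \<le> (\<integral>\<^sup>+x. G x * indicator {0..<1} x \<partial>lborel)"
proof -
  have "(\<Sum>i\<in>{()}. \<integral>\<^sup>+x. G (real D * x) * indicator {0..<1} x \<partial>lborel)
      \<le> ennreal (real D / real D) * (\<integral>\<^sup>+x. G x * indicator {0..<1} x \<partial>lborel)"
  proof (rule periodic_unfold_le[where H = "int D"])
    fix \<gamma> :: real assume \<gamma>: "0 \<le> \<gamma>" "\<gamma> < 1"
    have "{(i, h). i \<in> {()} \<and> h \<in> {- int D..<int D} \<and> (\<gamma> + real_of_int h) / real D \<in> {0..<1}}
       \<subseteq> {()} \<times> {0..<int D}"
      using \<gamma> D by (auto simp: field_simps)
    then have "card {(i, h). i \<in> {()} \<and> h \<in> {- int D..<int D} \<and> (\<gamma> + real_of_int h) / real D \<in> {0..<1}}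
       \<le> card ({()} \<times> {0..<int D})" by (intro card_mono) auto
    then show "real (card {(i, h). i \<in> {()} \<and> h \<in> {- int D..<int D} \<and> (\<gamma> + real_of_int h) / real D \<in> {0..<1}}) \<le> real D"
      by (simp add: card_cartesian_product)
  next
    fix x :: real assume "x \<in> {0..<1}"
    then have "0 \<le> real D * x" "real D * x < real D" using D by auto
    then show "- real_of_int (int D) \<le> real D * x \<and> real D * x < real_of_int (int D)"
      by (simp add: order_trans[of _ 0])
  qed (use assms in auto)
  then show ?thesis using D by simp
qed

section \<open>Integrals over families of arcs\<close>

definition arc_pairs :: "real \<Rightarrow> (int \<times> int) set" where
  "arc_pairs Q = {(q, a). 1 \<le> q \<and> real_of_int q \<le> Q \<and> 0 \<le> a \<and> a \<le> q \<and> coprime a q}"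

definition major_arc :: "real \<Rightarrow> int \<times> int \<Rightarrow> real set" where
  "major_arc \<rho> = (\<lambda>(q, a). {\<alpha>. \<bar>real_of_int q * \<alpha> - real_of_int a\<bar> \<le> \<rho>})"

lemma arc_pairs_subset: "arc_pairs Q \<subseteq> (SIGMA q:{1..\<lfloor>Q\<rfloor>}. {0..q})"
  by (auto simp: arc_pairs_def le_floor_iff)

lemma finite_arc_pairs: "finite (arc_pairs Q)"
  by (rule finite_subset[OF arc_pairs_subset]) auto

lemma major_arc_eq: "q \<ge> 1 \<Longrightarrow> major_arc \<rho> (q, a) = {(a - \<rho>) / q .. (a + \<rho>) / q}"
  by (auto simp: major_arc_def field_simps abs_le_iff)

lemma major_arc_measurable [measurable]: "major_arc \<rho> t \<in> sets borel"
proof -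
  have "closed (major_arc \<rho> t)"
    unfolding major_arc_def by (cases t) (auto intro!: closed_Collect_le continuous_intros)
  then show ?thesis by (rule borel_closed)
qed

text \<open>Each q admits at most q + 1 <= 2 q numerators, so its arcs have total length at most 4
  \<rho>.\<close>

lemma sum_arc_length_le:
  assumes "Q \<ge> 1" "\<rho> \<ge> 0"
  shows "(\<Sum>(q, a)\<in>arc_pairs Q. 2 * \<rho> / real_of_int q) \<le> 4 * Q * \<rho>"
proof -
  have "(\<Sum>(q, a)\<in>arc_pairs Q. 2 * \<rho> / real_of_int q) \<le> (\<Sum>(q, a)\<in>(SIGMA q:{1..\<lfloor>Q\<rfloor>}. {0..q}). 2 * \<rho> / real_of_int q)"
    using assms by (intro sum_mono2 arc_pairs_subset) auto
  also have "\<dots> = (\<Sum>q\<in>{1..\<lfloor>Q\<rfloor>}. \<Sum>a\<in>{0..q}. 2 * \<rho> / real_of_int q)"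
    by (rule sum.Sigma[symmetric]) auto
  also have "\<dots> \<le> (\<Sum>q\<in>{1..\<lfloor>Q\<rfloor>}. 4 * \<rho>)"
  proof (intro sum_mono)
    fix q assume q: "q \<in> {1..\<lfloor>Q\<rfloor>}"
    have "(\<Sum>a\<in>{0..q}. 2 * \<rho> / real_of_int q) = (real_of_int q + 1) * (2 * \<rho>) / real_of_int q"
      using q by simp
    also have "\<dots> \<le> (2 * real_of_int q) * (2 * \<rho>) / real_of_int q"
      using q assms by (intro divide_right_mono mult_right_mono) auto
    finally show "(\<Sum>a\<in>{0..q}. 2 * \<rho> / real_of_int q) \<le> 4 * \<rho>" using q by simp
  qed
  also have "\<dots> = of_int \<lfloor>Q\<rfloor> * (4 * \<rho>)" using assms by simp
  also have "\<dots> \<le> Q * (4 * \<rho>)" using assms by (intro mult_right_mono) auto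
  finally show ?thesis by simp
qed

text \<open>If (\<gamma> + h)/n lies on the arc of a/q, then |q \<gamma> - b| <= n \<rho> for b = n
  a - q h. Since (n, q) = 1, this b is coprime to q and the pair (q, b) determines a modulo q. The
  overlap is thus at most a count of approximations to \<gamma>; the factor 2 separates a = 0 from a
  = 1 when q = 1.\<close>

lemma arcs_integral_le:
  fixes G :: "real \<Rightarrow> ennreal" and n :: nat
  assumes [measurable]: "G \<in> borel_measurable borel"
    and per: "\<And>x h. G (x + of_int h) = G x" and n: "n \<ge> 1" and Q: "Q \<ge> 1" and \<rho>: "\<rho> \<ge> 0"
  shows "(\<Sum>t\<in>{(q, a) \<in> arc_pairs Q. coprime q (int n)}. \<integral>\<^sup>+x. G (real n * x) * indicator (major_arc \<rho> t) x \<partial>lborel)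
     \<le> ennreal (2 * ((1 + log 2 Q) * (1 + 8 * Q * (real n * \<rho>))) / real n) * (\<integral>\<^sup>+x. G x * indicator {0..<1} x \<partial>lborel)"
\<comment> \<open>Every arc lies in |x| <= 1 + \<rho>, because 0 <= a <= q.\<close>
proof (rule periodic_unfold_le[where H = "\<lfloor>real n * (1 + \<rho>)\<rfloor> + 1"])
  fix t x assume "t \<in> {(q, a) \<in> arc_pairs Q. coprime q (int n)}" "x \<in> major_arc \<rho> t"
  then obtain q a where t: "1 \<le> q" "0 \<le> a" "a \<le> q" "\<bar>real_of_int q * x - real_of_int a\<bar> \<le> \<rho>"
    by (auto simp: arc_pairs_def major_arc_def)
  have "real_of_int q * \<bar>x\<bar> = \<bar>real_of_int q * x\<bar>" using t by (simp add: abs_mult)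
  also have "\<dots> \<le> real_of_int a + \<rho>" using t by linarith
  also have "\<dots> \<le> real_of_int q + real_of_int q * \<rho>"
    using t \<rho> mult_right_mono[of 1 "real_of_int q" \<rho>] by simp
  finally have "real_of_int q * \<bar>x\<bar> \<le> real_of_int q * (1 + \<rho>)" by (simp add: ring_distribs)
  then have "\<bar>x\<bar> \<le> 1 + \<rho>" using t by simp
  then have "real n * \<bar>x\<bar> \<le> real n * (1 + \<rho>)" by (intro mult_left_mono) auto
  then have "\<bar>real n * x\<bar> \<le> real n * (1 + \<rho>)" by (simp add: abs_mult)
  then show "- real_of_int (\<lfloor>real n * (1 + \<rho>)\<rfloor> + 1) \<le> real n * x \<and> real n * x < real_of_int (\<lfloor>real n * (1 + \<rho>)\<rfloor> + 1)"
    by linarith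
next
  fix \<gamma> :: real assume "0 \<le> \<gamma>" "\<gamma> < 1"
  let ?H = "\<lfloor>real n * (1 + \<rho>)\<rfloor> + 1"
  let ?S = "{(t, h). t \<in> {(q, a) \<in> arc_pairs Q. coprime q (int n)} \<and> h \<in> {- ?H..<?H} \<and> (\<gamma> + real_of_int h) / real n \<in> major_arc \<rho> t}"
  let ?A = "approx_pairs Q (real n * \<rho>) \<gamma>"
  \<comment> \<open>The flag \<open>a = q\<close> is needed because \<open>arc_pairs\<close> contains both \<open>0/1\<close> and \<open>1/1\<close>.\<close>
  let ?\<phi> = "\<lambda>((q, a), h). ((q, int n * a - q * h), a = q)"
  have "inj_on ?\<phi> ?S"
  proof (rule inj_onI)
    fix u v assume uv: "u \<in> ?S" "v \<in> ?S" "?\<phi> u = ?\<phi> v"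
    obtain q a h where u: "u = ((q, a), h)" by (metis surj_pair)
    obtain q' a' h' where v: "v = ((q', a'), h')" by (metis surj_pair)
    have q: "q' = q" and eq: "int n * a - q * h = int n * a' - q * h'" and fl: "a = q \<longleftrightarrow> a' = q"
      using uv(3) by (auto simp: u v)
    have r: "1 \<le> q" "0 \<le> a" "a \<le> q" "0 \<le> a'" "a' \<le> q" "coprime q (int n)"
      using uv(1,2) q by (auto simp: u v arc_pairs_def)
    have "int n * (a - a') = q * (h - h')" using eq by (simp add: algebra_simps)
    then have "q dvd int n * (a - a')" by (metis dvd_triv_left)
    then have dv: "q dvd a - a'" using r(6) by (simp add: coprime_dvd_mult_right_iff)
    have "a = a'"
    proof (cases "a = q")
      case False
      then have "\<bar>a - a'\<bar> < q" using fl r by linarith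
      then show ?thesis using dv dvd_imp_le_int[of "a - a'" q] r(1) by fastforce
    qed (use fl in auto)
    moreover from this have "h = h'" using eq r(1) by simp
    ultimately show "u = v" by (simp add: u v q)
  qed
  moreover have "?\<phi> ` ?S \<subseteq> ?A \<times> UNIV"
  proof
    fix w assume "w \<in> ?\<phi> ` ?S"
    then obtain q a h where w: "w = ((q, int n * a - q * h), a = q)" and S: "((q, a), h) \<in> ?S" by auto
    have r: "1 \<le> q" "real_of_int q \<le> Q" "coprime a q" "coprime q (int n)"
       "\<bar>real_of_int q * ((\<gamma> + real_of_int h) / real n) - real_of_int a\<bar> \<le> \<rho>"
      using S by (auto simp: arc_pairs_def major_arc_def)
    have "coprime (int n * a - q * h) q"
    proof (rule coprimeI)
      fix c assume c: "c dvd int n * a - q * h" "c dvd q"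
      then have "c dvd int n * a" by (metis diff_add_cancel dvd_add dvd_mult2)
      moreover have "coprime (int n * a) q" using r by (simp add: coprime_commute)
      ultimately show "is_unit c" using c by (metis coprime_common_divisor)
    qed
    moreover have "\<bar>real_of_int q * \<gamma> - real_of_int (int n * a - q * h)\<bar> \<le> real n * \<rho>"
    proof -
      have "real_of_int q * \<gamma> - real_of_int (int n * a - q * h)
         = real n * (real_of_int q * ((\<gamma> + real_of_int h) / real n) - real_of_int a)"
        using n by (simp add: field_simps)
      then have "\<bar>real_of_int q * \<gamma> - real_of_int (int n * a - q * h)\<bar>
         = real n * \<bar>real_of_int q * ((\<gamma> + real_of_int h) / real n) - real_of_int a\<bar>"
        by (simp add: abs_mult)
      also have "\<dots> \<le> real n * \<rho>" using r by (intro mult_left_mono) auto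
      finally show ?thesis .
    qed
    ultimately show "w \<in> ?A \<times> UNIV" using r by (simp add: w approx_pairs_def)
  qed
  ultimately have "card ?S \<le> card (?A \<times> (UNIV :: bool set))"
    by (intro card_inj_on_le[where f = ?\<phi>]) (auto intro: finite_approx_pairs)
  then have "real (card ?S) \<le> 2 * real (card ?A)" by (simp add: card_cartesian_product)
  also have "\<dots> \<le> 2 * ((1 + log 2 Q) * (1 + 8 * Q * (real n * \<rho>)))"
    using card_approx_pairs_le[of "real n * \<rho>" Q \<gamma>] Q \<rho> by simp
  finally show "real (card ?S) \<le> 2 * ((1 + log 2 Q) * (1 + 8 * Q * (real n * \<rho>)))" .
qed (use assms finite_arc_pairs[of Q] in \<open>auto intro: finite_subset[OF _ finite_arc_pairs[of Q]]\<close>)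

lemma weyl_f_measurable [measurable]: "(\<lambda>\<alpha>. weyl_f k \<alpha> P R) \<in> borel_measurable borel"
  by (rule borel_measurable_continuous_onI[OF continuous_on_weyl_f])

lemma nn_integral_weyl_f_le_U:
  assumes "s > 0"
  shows "(\<integral>\<^sup>+x. ennreal (cmod (weyl_f k x P R) powr s) * indicator {0..<1} x \<partial>lborel) \<le> ennreal (U k s P R)"
proof -
  have "(\<integral>\<^sup>+x. ennreal (cmod (weyl_f k x P R) powr s) * indicator {0..<1} x \<partial>lborel)
     \<le> (\<integral>\<^sup>+x. ennreal (indicator {0..1} x *\<^sub>R (cmod (weyl_f k x P R) powr s)) \<partial>lborel)"
    by (intro nn_integral_mono) (auto simp: indicator_def)
  also have "\<dots> = ennreal (U k s P R)"
    unfolding U_def set_lebesgue_integral_def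
    using set_integrable_weyl_f_powr[OF assms, of k P R]
    by (intro nn_integral_eq_integral) (auto simp: set_integrable_def)
  finally show ?thesis .
qed

text \<open>Only m^k is known to be coprime to q, so only this dilation acts on the arcs. It is
  applied to x -> |f(d^k x)|^s, still of period 1, and replaces the arcs by the full period. There
  d^k can be removed even if it shares factors with q.\<close>

lemma leaf_integral_le:
  fixes m d :: nat
  assumes "s > 0" "m \<ge> 1" "d \<ge> 1" "Q \<ge> 1" "\<rho> \<ge> 0"
  shows "(\<Sum>t\<in>{(q, a) \<in> arc_pairs Q. coprime q (int (m ^ k))}.
       \<integral>\<^sup>+x. ennreal (cmod (weyl_f k (real (d ^ k) * (real (m ^ k) * x)) Y R) powr s) * indicator (major_arc \<rho> t) x \<partial>lborel)
     \<le> ennreal (2 * ((1 + log 2 Q) * (1 + 8 * Q * (real (m ^ k) * \<rho>))) / real (m ^ k) * U k s Y R)"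
proof -
  let ?g = "\<lambda>x. ennreal (cmod (weyl_f k x Y R) powr s)"
  let ?G = "\<lambda>x. ?g (real (d ^ k) * x)"
  let ?c = "2 * ((1 + log 2 Q) * (1 + 8 * Q * (real (m ^ k) * \<rho>))) / real (m ^ k)"
  have per: "?g (x + of_int h) = ?g x" for x h by (simp add: weyl_f_add_int)
  have "?G (x + of_int h) = ?g (real (d ^ k) * x + of_int (int (d ^ k) * h))" for x h
    by (simp add: ring_distribs)
  then have perG: "?G (x + of_int h) = ?G x" for x h by (simp only: per)
  have mk: "m ^ k \<ge> 1" "d ^ k \<ge> 1" using assms by simp_all
  have c: "?c \<ge> 0" using assms by (intro divide_nonneg_nonneg mult_nonneg_nonneg add_nonneg_nonneg) auto
  have "(\<Sum>t\<in>{(q, a) \<in> arc_pairs Q. coprime q (int (m ^ k))}. \<integral>\<^sup>+x. ?G (real (m ^ k) * x) * indicator (major_arc \<rho> t) x \<partial>lborel)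
     \<le> ennreal ?c * (\<integral>\<^sup>+x. ?G x * indicator {0..<1} x \<partial>lborel)"
    by (rule arcs_integral_le[OF _ perG mk(1) assms(4,5)]) measurable
  also have "(\<integral>\<^sup>+x. ?G x * indicator {0..<1} x \<partial>lborel) \<le> (\<integral>\<^sup>+x. ?g x * indicator {0..<1} x \<partial>lborel)"
    by (rule periodic_dilation_le[OF _ per mk(2)]) measurable
  also have "\<dots> \<le> ennreal (U k s Y R)" by (rule nn_integral_weyl_f_le_U[OF assms(1)])
  also have "ennreal ?c * ennreal (U k s Y R) = ennreal (?c * U k s Y R)"
    by (rule ennreal_mult'[OF c, symmetric])
  finally show ?thesis by (simp add: mult_left_mono)
qed

section \<open>Elementary inequalities\<close>

lemma sum_powr_le:
  fixes x :: "'a \<Rightarrow> real"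
  assumes "finite T" "\<And>t. t \<in> T \<Longrightarrow> x t \<ge> 0" "s \<ge> 1"
  shows "(\<Sum>t\<in>T. x t) powr s \<le> real (card T) powr (s - 1) * (\<Sum>t\<in>T. x t powr s)"
proof -
  \<comment> \<open>Zero terms contribute to neither side; discarding them keeps the convexity
    argument on the positive reals.\<close>
  define S where "S = {t \<in> T. x t > 0}"
  have S: "finite S" "S \<subseteq> T" using assms by (auto simp: S_def)
  have zero: "x t = 0" if "t \<in> T - S" for t using that assms(2)[of t] by (auto simp: S_def)
  have 1: "(\<Sum>t\<in>T. x t) = (\<Sum>t\<in>S. x t)" using zero S assms(1) by (intro sum.mono_neutral_right) auto
  have 2: "(\<Sum>t\<in>T. x t powr s) = (\<Sum>t\<in>S. x t powr s)" using zero S assms(1) by (intro sum.mono_neutral_right) auto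
  show ?thesis
  proof (cases "S = {}")
    case True
    then show ?thesis using 1 2 by simp
  next
    case False
    define c where "c = real (card S)"
    have c: "c > 0" using False S by (simp add: c_def card_gt_0_iff)
    have "(\<Sum>t\<in>S. (1 / c) *\<^sub>R x t) powr s \<le> (\<Sum>t\<in>S. (1 / c) * (x t powr s))"
      using S False c by (intro convex_on_sum[OF _ _ powr_convex[OF assms(3)]]) (auto simp: c_def S_def)
    then have "((\<Sum>t\<in>S. x t) / c) powr s \<le> (\<Sum>t\<in>S. x t powr s) / c"
      by (simp add: sum_divide_distrib)
    then have "(\<Sum>t\<in>S. x t) powr s / c powr s \<le> (\<Sum>t\<in>S. x t powr s) / c"
      using c by (subst (asm) powr_divide) (auto simp: S_def intro: sum_nonneg)
    then have "(\<Sum>t\<in>S. x t) powr s \<le> c powr (s - 1) * (\<Sum>t\<in>S. x t powr s)"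
      using c by (simp add: powr_diff field_simps)
    also have "\<dots> \<le> real (card T) powr (s - 1) * (\<Sum>t\<in>S. x t powr s)"
      using c S assms by (intro mult_right_mono powr_mono2 sum_nonneg) (auto simp: c_def intro: card_mono)
    finally show ?thesis using 1 2 by simp
  qed
qed

lemma add_powr_le:
  fixes a b s :: real
  assumes "a \<ge> 0" "b \<ge> 0" "s \<ge> 0"
  shows "(a + b) powr s \<le> 2 powr s * (a powr s + b powr s)"
proof -
  have "(a + b) powr s \<le> (2 * max a b) powr s" using assms by (intro powr_mono2) auto
  also have "\<dots> = 2 powr s * max a b powr s" using assms by (simp add: powr_mult)
  also have "max a b powr s \<le> a powr s + b powr s" by (auto simp: max_def)
  finally show ?thesis by (simp add: mult_left_mono)
qed

text \<open>The difference between the harmonic number and ln n decreases from its value 1 at n = 1;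
  \<open>max 1\<close> covers n = 0.\<close>

lemma sum_inverse_le: "(\<Sum>d\<in>{1..n}. 1 / real d) \<le> 1 + ln (max 1 (real n))"
proof (cases n)
  case (Suc j)
  have "harm (Suc j) - ln (real (Suc j)) \<le> harm (Suc 0) - ln (real (Suc 0))"
    using decseq_harm_diff_ln[unfolded decseq_def, rule_format, of 0 j] by simp
  then show ?thesis using Suc by (simp add: harm_def field_simps)
qed simp

section \<open>The major arcs\<close>

text \<open>As m > M, both P/(m d) and m^(-k) may be estimated with M in place of m. Enlarging the
  index set to a box then separates the three sums: r and m contribute R and M R terms, and d a
  harmonic sum.\<close>

lemma sum_triples_le:
  assumes "M \<ge> 1" "R \<ge> 1" "P \<ge> M" "\<sigma> \<ge> 1"
  shows "(\<Sum>(r, m, d)\<in>triples M P R. (P / real (m * d)) powr \<sigma> / real (m ^ k))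
     \<le> R * (M * R) * ((P / M) powr \<sigma> / M ^ k) * (1 + ln P)"
proof -
  let ?c = "(P / M) powr \<sigma> / M ^ k"
  let ?T = "{1..nat \<lfloor>R\<rfloor>} \<times> {1..nat \<lfloor>M * R\<rfloor>} \<times> {1..nat \<lfloor>P\<rfloor>}"
  have P: "P \<ge> 1" using assms by linarith
  have "(\<Sum>(r, m, d)\<in>triples M P R. (P / real (m * d)) powr \<sigma> / real (m ^ k))
      \<le> (\<Sum>(r, m, d)\<in>triples M P R. ?c * (1 / real d))"
  proof (intro sum_mono)
    fix t assume "t \<in> triples M P R"
    then obtain r m d where t: "t = (r, m, d)" "M < real m" "1 \<le> d" by (auto simp: triples_def)
    have "real (m * d) \<ge> M * real d" using t by simp
    then have "P / real (m * d) \<le> P / (M * real d)" using t assms P by (intro divide_left_mono) auto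
    then have "(P / real (m * d)) powr \<sigma> \<le> (P / M / real d) powr \<sigma>"
      using assms P by (intro powr_mono2) auto
    also have "\<dots> = (P / M) powr \<sigma> / real d powr \<sigma>"
      using assms P t by (intro powr_divide)
    also have "\<dots> \<le> (P / M) powr \<sigma> / real d"
      using t assms powr_mono[of 1 \<sigma> "real d"] by (intro divide_left_mono) auto
    finally have "(P / real (m * d)) powr \<sigma> \<le> (P / M) powr \<sigma> / real d" .
    then have "(P / real (m * d)) powr \<sigma> / real (m ^ k) \<le> (P / M) powr \<sigma> / real d / M ^ k"
      using t assms by (intro frac_le) (auto intro: power_mono)
    then show "(case t of (r, m, d) \<Rightarrow> (P / real (m * d)) powr \<sigma> / real (m ^ k))
       \<le> (case t of (r, m, d) \<Rightarrow> ?c * (1 / real d))" by (simp add: t mult_ac)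
  qed
  also have "\<dots> \<le> (\<Sum>(r, m, d)\<in>?T. ?c * (1 / real d))"
    using assms by (intro sum_mono2 triples_subset) auto
  also have "\<dots> = real (nat \<lfloor>R\<rfloor>) * (real (nat \<lfloor>M * R\<rfloor>) * (?c * (\<Sum>d\<in>{1..nat \<lfloor>P\<rfloor>}. 1 / real d)))"
    by (simp add: sum.cartesian_product[symmetric] sum_distrib_left)
  also have "\<dots> \<le> R * ((M * R) * (?c * (1 + ln P)))"
  proof (intro mult_mono)
    have "(\<Sum>d\<in>{1..nat \<lfloor>P\<rfloor>}. 1 / real d) \<le> 1 + ln (max 1 (real (nat \<lfloor>P\<rfloor>)))" by (rule sum_inverse_le)
    also have "\<dots> \<le> 1 + ln P" using P by simp
    finally show "(\<Sum>d\<in>{1..nat \<lfloor>P\<rfloor>}. 1 / real d) \<le> 1 + ln P" .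
  qed (use assms P in \<open>auto intro!: sum_nonneg mult_nonneg_nonneg divide_nonneg_nonneg\<close>)
  finally show ?thesis by (simp add: mult.assoc)
qed

lemma major_arcs_subset: "major_arcs k Q P \<subseteq> (\<Union>t\<in>arc_pairs Q. major_arc (Q * P powr (- real k)) t)"
  by (force simp: major_arcs_def arc_pairs_def major_arc_def)

text \<open>Hoelder is applied over \<open>triples_for\<close>, where the condition on d leaves at
  most R (M R) V terms. Only afterwards is that condition dropped, so that the index set depends on
  q through the coprimality of m and q alone, a condition that can be read as one on q once the
  triple is fixed.\<close>

lemma norm_weyl_f_powr_le:
  assumes "M \<ge> 1" "P \<ge> 1" "R \<ge> 1" "q \<ge> 1" "s \<ge> 2" "k \<ge> 1"
    and V: "real (card (prime_supported (prime_factors q) (nat \<lfloor>P\<rfloor>))) \<le> V"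
  shows "cmod (weyl_f k \<alpha> P R) powr s \<le> 2 powr s * (M * V) powr s
     + 2 powr s * (R * (M * R) * V) powr (s - 1) * (\<Sum>(r, m, d)\<in>{(r, m, d)\<in>triples M P R. coprime (int q) (int (m ^ k))}.
          cmod (weyl_f k (real (d ^ k) * (real (m ^ k) * \<alpha>)) (P / real (m * d)) (real r)) powr s)"
proof -
  let ?g = "\<lambda>(r, m, d). cmod (weyl_f k (real (d ^ k) * (real (m ^ k) * \<alpha>)) (P / real (m * d)) (real r))"
  let ?T = "triples_for M P R q"
  have V0: "V \<ge> 0" using V by linarith
  have g0: "?g t \<ge> 0" for t by (simp split: prod.splits)
  have sub: "?T \<subseteq> {(r, m, d)\<in>triples M P R. coprime (int q) (int (m ^ k))}"
    by (auto simp: triples_for_def coprime_commute coprime_int_iff)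
  have fin: "finite {(r, m, d)\<in>triples M P R. coprime (int q) (int (m ^ k))}"
    by (rule finite_subset[OF _ finite_triples[OF assms(1), of P R]]) auto
  have "cmod (weyl_f k \<alpha> P R) \<le> M * V + (\<Sum>t\<in>?T. ?g t)"
    using norm_weyl_f_le_sum[OF assms(1-4), of k \<alpha>] mult_left_mono[OF V, of M] assms(1) by linarith
  then have "cmod (weyl_f k \<alpha> P R) powr s \<le> (M * V + (\<Sum>t\<in>?T. ?g t)) powr s"
    using assms by (intro powr_mono2) auto
  also have "\<dots> \<le> 2 powr s * ((M * V) powr s + (\<Sum>t\<in>?T. ?g t) powr s)"
    using assms V0 g0 by (intro add_powr_le sum_nonneg) auto
  also have "(\<Sum>t\<in>?T. ?g t) powr s \<le> real (card ?T) powr (s - 1) * (\<Sum>t\<in>?T. ?g t powr s)"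
    using assms g0 by (intro sum_powr_le finite_triples_for) auto
  also have "\<dots> \<le> (R * (M * R) * V) powr (s - 1) *
      (\<Sum>t\<in>{(r, m, d)\<in>triples M P R. coprime (int q) (int (m ^ k))}. ?g t powr s)"
  proof (intro mult_mono powr_mono2 sum_mono2 fin sub)
    have "real (card ?T) \<le> R * (M * R) * real (card (prime_supported (prime_factors q) (nat \<lfloor>P\<rfloor>)))"
      using assms by (intro card_triples_for_le)
    also have "\<dots> \<le> R * (M * R) * V" using V assms by (intro mult_left_mono) auto
    finally show "real (card ?T) \<le> R * (M * R) * V" .
  qed (use assms in \<open>auto intro: sum_nonneg\<close>)
  finally show ?thesis by (simp add: ring_distribs mult.assoc case_prod_unfold)
qed

lemma nn_integral_weighted_cover:
  fixes g :: "'t \<Rightarrow> 'a \<Rightarrow> ennreal" and A :: "'u \<Rightarrow> 'a set"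
  assumes g [measurable]: "\<And>t. g t \<in> borel_measurable M" and A [measurable]: "\<And>u. A u \<in> sets M"
  shows "(\<integral>\<^sup>+x. (\<Sum>u\<in>I. a * indicator (A u) x + b * (\<Sum>t\<in>T u. g t x * indicator (A u) x)) \<partial>M)
     = a * (\<Sum>u\<in>I. emeasure M (A u)) + b * (\<Sum>u\<in>I. \<Sum>t\<in>T u. \<integral>\<^sup>+x. g t x * indicator (A u) x \<partial>M)"
  by (simp add: nn_integral_sum nn_integral_add nn_integral_cmult sum.distrib sum_distrib_left)

text \<open>The decomposition of f depends on q, so each arc receives the pointwise bound for its
  own denominator, and the arcs are summed as a cover, without disjointness. \<open>V\<close> and
  \<open>W\<close> stand for the divisor-type bound and the moment bound. The first term of the
  result is the contribution of the exceptional integers: their bound times the total length of the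
  arcs.\<close>

lemma major_arcs_integral_le:
  fixes k :: nat
  assumes "k \<ge> 1" "s \<ge> 2" "\<sigma> \<ge> 1" "M \<ge> 1" "P \<ge> M" "R \<ge> 1" "Q \<ge> 1"
    and \<rho>: "\<rho> = Q * P powr (- real k)" and M: "(M * R) ^ k * \<rho> * Q \<le> R ^ k"
    and V: "\<And>q. 1 \<le> q \<Longrightarrow> real q \<le> Q \<Longrightarrow> real (card (prime_supported (prime_factors q) (nat \<lfloor>P\<rfloor>))) \<le> V"
    and W: "\<And>Y r. 1 \<le> Y \<Longrightarrow> Y \<le> P \<Longrightarrow> 1 \<le> r \<Longrightarrow> r \<le> R \<Longrightarrow> U k s Y r \<le> W * Y powr \<sigma>"
    and "W \<ge> 0"
  shows "(LINT \<alpha>:major_arcs k Q P|lborel. cmod (weyl_f k \<alpha> P R) powr s)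
     \<le> 2 powr s * (M * V) powr s * (4 * Q * \<rho>)
      + 2 powr s * (R * (M * R) * V) powr (s - 1) * (2 * ((1 + log 2 Q) * (1 + 8 * R ^ k)) * W *
          (R * (M * R) * ((P / M) powr \<sigma> / M ^ k) * (1 + ln P)))" (is "_ \<le> ?A * (4 * Q * \<rho>) + ?B * (?K * W * ?X)")
proof -
  let ?F = "\<lambda>\<alpha>. cmod (weyl_f k \<alpha> P R) powr s"
  let ?g = "\<lambda>t \<alpha>. case t of (r, m, d) \<Rightarrow> cmod (weyl_f k (real (d ^ k) * (real (m ^ k) * \<alpha>)) (P / real (m * d)) (real r)) powr s"
  let ?T = "triples M P R"
  let ?c = "\<lambda>t u. coprime (fst u) (int (fst (snd t) ^ k))"
  have P: "P \<ge> 1" and V0: "V \<ge> 0" using V[of 1] assms by auto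
  have \<rho>0: "\<rho> \<ge> 0" using assms by (simp add: \<rho>)
  have AB: "?A \<ge> 0" "?B \<ge> 0" by simp_all
  have finT: "finite ?T" by (rule finite_triples[OF assms(4)])
  have meas_g [measurable]: "?g t \<in> borel_measurable borel" for t by (cases t) simp
  have pt: "?F \<alpha> \<le> ?A + ?B * (\<Sum>t\<in>{t\<in>?T. ?c t u}. ?g t \<alpha>)" if u: "u \<in> arc_pairs Q" for u \<alpha>
  proof -
    obtain q a where q: "u = (q, a)" "1 \<le> q" "real_of_int q \<le> Q" using u by (auto simp: arc_pairs_def)
    have nq: "1 \<le> nat q" "real (nat q) \<le> Q" using q by auto
    have "?F \<alpha> \<le> ?A + ?B * (\<Sum>(r, m, d)\<in>{(r, m, d)\<in>?T. coprime (int (nat q)) (int (m ^ k))}.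
          cmod (weyl_f k (real (d ^ k) * (real (m ^ k) * \<alpha>)) (P / real (m * d)) (real r)) powr s)"
      using assms P nq by (intro norm_weyl_f_powr_le V) auto
    also have "{(r, m, d)\<in>?T. coprime (int (nat q)) (int (m ^ k))} = {t\<in>?T. ?c t u}"
      using q by auto
    finally show ?thesis .
  qed
  have sum1: "(\<Sum>u\<in>arc_pairs Q. emeasure lborel (major_arc \<rho> u)) \<le> ennreal (4 * Q * \<rho>)"
  proof -
    have "(\<Sum>u\<in>arc_pairs Q. emeasure lborel (major_arc \<rho> u)) = (\<Sum>u\<in>arc_pairs Q. ennreal (case u of (q, a) \<Rightarrow> 2 * \<rho> / real_of_int q))"
    proof (intro sum.cong refl)
      fix u assume "u \<in> arc_pairs Q"
      then obtain q a where q: "u = (q, a)" "1 \<le> q" by (auto simp: arc_pairs_def)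
      have "(a - \<rho>) / real_of_int q \<le> (a + \<rho>) / real_of_int q" using q \<rho>0 by (intro divide_right_mono) auto
      moreover have "(a + \<rho>) / real_of_int q - (a - \<rho>) / real_of_int q = 2 * \<rho> / real_of_int q"
        by (simp add: diff_divide_distrib[symmetric])
      ultimately show "emeasure lborel (major_arc \<rho> u) = ennreal (case u of (q, a) \<Rightarrow> 2 * \<rho> / real_of_int q)"
        using q by (simp add: major_arc_eq)
    qed
    also have "\<dots> = ennreal (\<Sum>(q, a)\<in>arc_pairs Q. 2 * \<rho> / real_of_int q)"
      using \<rho>0 by (intro sum_ennreal) (auto simp: arc_pairs_def)
    also have "\<dots> \<le> ennreal (4 * Q * \<rho>)" using assms \<rho>0 by (intro ennreal_leI sum_arc_length_le)
    finally show ?thesis .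
  qed
  have leaf: "(\<Sum>u\<in>{u\<in>arc_pairs Q. ?c t u}. \<integral>\<^sup>+\<alpha>. ennreal (?g t \<alpha>) * indicator (major_arc \<rho> u) \<alpha> \<partial>lborel)
     \<le> ennreal (?K * W * (case t of (r, m, d) \<Rightarrow> (P / real (m * d)) powr \<sigma> / real (m ^ k)))" if t: "t \<in> ?T" for t
  proof -
    obtain r m d where rmd: "t = (r, m, d)" "1 \<le> r" "real r \<le> R" "M < real m" "real m \<le> M * R" "1 \<le> d"
      "real (m * d) \<le> P" using t by (auto simp: triples_def)
    have m: "m \<ge> 1" using rmd assms by linarith
    have md: "real (m * d) \<ge> 1" using m rmd by (metis mult_le_mono mult_1 of_nat_1 of_nat_mono)
    have Y: "1 \<le> P / real (m * d)" "P / real (m * d) \<le> P"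
      using md rmd P by (auto simp: field_simps)
    have "{u\<in>arc_pairs Q. ?c t u} = {(q, a) \<in> arc_pairs Q. coprime q (int (m ^ k))}" using rmd by auto
    then have "(\<Sum>u\<in>{u\<in>arc_pairs Q. ?c t u}. \<integral>\<^sup>+\<alpha>. ennreal (?g t \<alpha>) * indicator (major_arc \<rho> u) \<alpha> \<partial>lborel)
      \<le> ennreal (2 * ((1 + log 2 Q) * (1 + 8 * Q * (real (m ^ k) * \<rho>))) / real (m ^ k) * U k s (P / real (m * d)) (real r))"
      using leaf_integral_le[of s m d Q \<rho> k "P / real (m * d)" "real r"] assms m rmd \<rho>0 by simp
    also have "\<dots> \<le> ennreal (?K / real (m ^ k) * (W * (P / real (m * d)) powr \<sigma>))"
    proof (intro ennreal_leI)
      have "2 * ((1 + log 2 Q) * (1 + 8 * Q * (real (m ^ k) * \<rho>))) / real (m ^ k) * U k s (P / real (m * d)) (real r)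
        \<le> 2 * ((1 + log 2 Q) * (1 + 8 * Q * (real (m ^ k) * \<rho>))) / real (m ^ k) * (W * (P / real (m * d)) powr \<sigma>)"
        using rmd Y assms(7) \<rho>0
        by (intro mult_left_mono W divide_nonneg_nonneg mult_nonneg_nonneg add_nonneg_nonneg) auto
      also have "\<dots> \<le> ?K / real (m ^ k) * (W * (P / real (m * d)) powr \<sigma>)"
      \<comment> \<open>Since m <= M R, the hypothesis on \<open>M\<close> bounds the overlap of the
        dilated arcs by a power of R, up to the logarithm.\<close>
      proof (intro mult_right_mono divide_right_mono mult_left_mono add_left_mono)
        have "real (m ^ k) * \<rho> * Q \<le> (M * R) ^ k * \<rho> * Q"
          using rmd assms(7) \<rho>0 by (intro mult_right_mono) (auto intro: power_mono)
        then show "8 * Q * (real (m ^ k) * \<rho>) \<le> 8 * R ^ k" using M by (simp add: mult_ac)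
      qed (use assms in auto)
      finally show "2 * ((1 + log 2 Q) * (1 + 8 * Q * (real (m ^ k) * \<rho>))) / real (m ^ k) * U k s (P / real (m * d)) (real r)
         \<le> ?K / real (m ^ k) * (W * (P / real (m * d)) powr \<sigma>)" .
    qed
    finally show ?thesis using rmd by (simp add: mult_ac)
  qed
  have K0: "?K * W \<ge> 0" using assms by (intro mult_nonneg_nonneg add_nonneg_nonneg) auto
  have sum2: "(\<Sum>u\<in>arc_pairs Q. \<Sum>t\<in>{t\<in>?T. ?c t u}. \<integral>\<^sup>+\<alpha>. ennreal (?g t \<alpha>) * indicator (major_arc \<rho> u) \<alpha> \<partial>lborel)
     \<le> ennreal (?K * W * ?X)"
  proof -
    \<comment> \<open>With the triple fixed, the arcs that remain are those with denominator coprime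
      to m^k, exactly the family whose dilation is controlled.\<close>
    have "(\<Sum>u\<in>arc_pairs Q. \<Sum>t\<in>{t\<in>?T. ?c t u}. \<integral>\<^sup>+\<alpha>. ennreal (?g t \<alpha>) * indicator (major_arc \<rho> u) \<alpha> \<partial>lborel)
      = (\<Sum>t\<in>?T. \<Sum>u\<in>{u\<in>arc_pairs Q. ?c t u}. \<integral>\<^sup>+\<alpha>. ennreal (?g t \<alpha>) * indicator (major_arc \<rho> u) \<alpha> \<partial>lborel)"
      by (rule sum.swap_restrict[OF finite_arc_pairs finT])
    also have "\<dots> \<le> (\<Sum>t\<in>?T. ennreal (?K * W * (case t of (r, m, d) \<Rightarrow> (P / real (m * d)) powr \<sigma> / real (m ^ k))))"
      by (intro sum_mono leaf)
    also have "\<dots> = ennreal (\<Sum>t\<in>?T. ?K * W * (case t of (r, m, d) \<Rightarrow> (P / real (m * d)) powr \<sigma> / real (m ^ k)))"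
      by (intro sum_ennreal mult_nonneg_nonneg[OF K0]) (auto split: prod.splits)
    also have "\<dots> \<le> ennreal (?K * W * ?X)"
      unfolding sum_distrib_left[symmetric] using assms K0
      by (intro ennreal_leI mult_left_mono sum_triples_le) auto
    finally show ?thesis .
  qed
  have X0: "?X \<ge> 0" using assms P by (intro mult_nonneg_nonneg divide_nonneg_nonneg add_nonneg_nonneg) auto
  have AX: "?A * (4 * Q * \<rho>) \<ge> 0" using AB(1) assms(7) \<rho>0 by (intro mult_nonneg_nonneg) auto
  have BX: "?B * (?K * W * ?X) \<ge> 0" by (rule mult_nonneg_nonneg[OF AB(2) mult_nonneg_nonneg[OF K0 X0]])
  have "(\<integral>\<^sup>+\<alpha>. ennreal (indicator (major_arcs k Q P) \<alpha> *\<^sub>R ?F \<alpha>) \<partial>lborel)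
     \<le> (\<integral>\<^sup>+\<alpha>. (\<Sum>u\<in>arc_pairs Q. ennreal ?A * indicator (major_arc \<rho> u) \<alpha>
          + ennreal ?B * (\<Sum>t\<in>{t\<in>?T. ?c t u}. ennreal (?g t \<alpha>) * indicator (major_arc \<rho> u) \<alpha>)) \<partial>lborel)"
  proof (intro nn_integral_mono)
    fix \<alpha> :: real
    let ?S = "\<lambda>u. ennreal ?A * indicator (major_arc \<rho> u) \<alpha>
          + ennreal ?B * (\<Sum>t\<in>{t\<in>?T. ?c t u}. ennreal (?g t \<alpha>) * indicator (major_arc \<rho> u) \<alpha>)"
    show "ennreal (indicator (major_arcs k Q P) \<alpha> *\<^sub>R ?F \<alpha>) \<le> (\<Sum>u\<in>arc_pairs Q. ?S u)"
    proof (cases "\<alpha> \<in> major_arcs k Q P")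
      case True
      then obtain u where u: "u \<in> arc_pairs Q" "\<alpha> \<in> major_arc \<rho> u" using major_arcs_subset \<rho> by blast
      have "ennreal (indicator (major_arcs k Q P) \<alpha> *\<^sub>R ?F \<alpha>) \<le> ennreal (?A + ?B * (\<Sum>t\<in>{t\<in>?T. ?c t u}. ?g t \<alpha>))"
        using pt[OF u(1)] True by (intro ennreal_leI) simp
      also have "\<dots> = ennreal ?A + ennreal ?B * (\<Sum>t\<in>{t\<in>?T. ?c t u}. ennreal (?g t \<alpha>))"
      proof -
        have g0: "?g t \<alpha> \<ge> 0" for t by (simp split: prod.splits)
        then have s0: "(\<Sum>t\<in>{t\<in>?T. ?c t u}. ?g t \<alpha>) \<ge> 0" by (intro sum_nonneg)
        show ?thesis
          unfolding sum_ennreal[of _ "\<lambda>t. ?g t \<alpha>", OF g0]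
            ennreal_plus[OF AB(1) mult_nonneg_nonneg[OF AB(2) s0]] ennreal_mult'[OF AB(2)] ..
      qed
      also have "\<dots> = ?S u" using u by simp
      also have "\<dots> \<le> (\<Sum>u\<in>arc_pairs Q. ?S u)"
        using u(1) finite_arc_pairs by (intro member_le_sum) auto
      finally show ?thesis .
    qed simp
  qed
  also have "\<dots> = ennreal ?A * (\<Sum>u\<in>arc_pairs Q. emeasure lborel (major_arc \<rho> u)) + ennreal ?B *
      (\<Sum>u\<in>arc_pairs Q. \<Sum>t\<in>{t\<in>?T. ?c t u}. \<integral>\<^sup>+\<alpha>. ennreal (?g t \<alpha>) * indicator (major_arc \<rho> u) \<alpha> \<partial>lborel)"
    using measurable_compose[OF meas_g measurable_ennreal] by (intro nn_integral_weighted_cover) simp_all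
  also have "\<dots> \<le> ennreal ?A * ennreal (4 * Q * \<rho>) + ennreal ?B * ennreal (?K * W * ?X)"
    by (intro add_mono mult_left_mono sum1 sum2) auto
  also have "ennreal ?A * ennreal (4 * Q * \<rho>) + ennreal ?B * ennreal (?K * W * ?X)
      = ennreal (?A * (4 * Q * \<rho>) + ?B * (?K * W * ?X))"
    by (simp only: ennreal_plus[OF AX BX] ennreal_mult'[OF AB(1), of "4 * Q * \<rho>"]
        ennreal_mult'[OF AB(2), of "?K * W * ?X"])
  \<comment> \<open>Measurability of \<open>major_arcs\<close> is not established: a non-integrable
    integrand would have integral 0, and the bound is nonnegative.\<close>
  finally show ?thesis
    unfolding set_lebesgue_integral_def by (rule integral_real_bounded[OF add_nonneg_nonneg[OF AX BX]])
qed

text \<open>The three uses of M. In the first, M^s collects M^(s - 1) from Hoelder and M from the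
  number of m; M^(-k) comes from the dilation and the power of P/M from the moment of the inner sum.
  The second is M^s for the exceptional integers times the total arc length. The third is the
  covering condition that determines M.\<close>

lemma main_term_identity:
  fixes P Q s \<Delta> :: real and k :: nat
  assumes "P \<ge> 1" "Q \<ge> 1" "k \<ge> 1"
  defines "M \<equiv> P * Q powr (- (2 / real k))"
  shows "M powr s * ((P / M) powr (s - real k + \<Delta>) / M ^ k) = P powr (s - real k) * Q powr (2 * \<Delta> / real k)"
    and "M powr s * (Q * (Q * P powr (- real k))) = P powr (s - real k) * Q powr (2 - 2 * s / real k)"
    and "M ^ k * (Q * P powr (- real k)) * Q = 1"
proof -
  have lM: "ln M = ln P - 2 / real k * ln Q" "M > 0"
    using assms by (simp_all add: M_def ln_mult ln_powr)
  \<comment> \<open>Every factor becomes the exponential of a linear form in ln P and ln Q, so each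
    identity reduces to comparing exponents.\<close>
  have ex: "M powr a = exp (a * (ln P - 2 / real k * ln Q))" "P powr a = exp (a * ln P)"
     "Q powr a = exp (a * ln Q)" "M ^ k = exp (real k * (ln P - 2 / real k * ln Q))" for a
    using lM assms by (simp_all add: powr_def flip: powr_realpow)
  have PM: "P / M = Q powr (2 / real k)"
    using assms by (simp add: M_def powr_minus field_simps)
  have PMa: "(P / M) powr a = exp (2 / real k * a * ln Q)" for a
    unfolding PM powr_powr by (simp add: ex)
  have Qe: "Q = exp (ln Q)" using assms by simp
  show "M powr s * ((P / M) powr (s - real k + \<Delta>) / M ^ k) = P powr (s - real k) * Q powr (2 * \<Delta> / real k)"
    unfolding PMa ex exp_diff[symmetric] exp_add[symmetric]
    using assms by (simp add: field_simps)
  show "M powr s * (Q * (Q * P powr (- real k))) = P powr (s - real k) * Q powr (2 - 2 * s / real k)"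
    by (subst (1 2) Qe, unfold ex exp_add[symmetric]) (use assms in \<open>simp add: field_simps\<close>)
  show "M ^ k * (Q * P powr (- real k)) * Q = 1"
    by (subst (1 2) Qe, unfold ex exp_add[symmetric]) (use assms in \<open>simp add: field_simps\<close>)
qed

theorem theorem4p2:
  fixes k :: nat and s \<Delta> :: real
  assumes "k \<ge> 1" and "s \<ge> 2" and "admissible_exponent k s \<Delta>"
  shows "\<forall>\<epsilon>>0. \<exists>\<eta>>0. \<exists>C. \<exists>P0. \<forall>P\<ge>P0. \<forall>R Q.
           2 \<le> R \<and> R \<le> P powr \<eta> \<and> 1 \<le> Q \<and> Q \<le> P powr (real k / 2) \<longrightarrow>
           (LINT \<alpha>:major_arcs k Q P|lborel. cmod (weyl_f k \<alpha> P R) powr s)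
             \<le> C * P powr (s - real k + \<epsilon>) * Q powr (2 * \<Delta> / real k)"
proof (intro allI impI)
  fix \<epsilon> :: real assume \<epsilon>: "\<epsilon> > 0"
  define \<sigma> where "\<sigma> = s - real k + \<Delta>"
  \<comment> \<open>With p = P^\<epsilon>1 the losses add up to p^(s + 3): p^(s - 1) from the number
    of d in Hoelder, and one p each from log Q, from the moment bound, from ln P and from the powers
    of R.\<close>
  define \<epsilon>1 where "\<epsilon>1 = \<epsilon> / (s + 3)"
  have \<sigma>: "\<sigma> \<ge> 1" unfolding \<sigma>_def by (rule admissible_exponent_ge[OF assms])
  have \<epsilon>1: "\<epsilon>1 > 0" "\<epsilon>1 * (s + 3) = \<epsilon>" using \<epsilon> assms(2) by (simp_all add: \<epsilon>1_def)
  obtain \<eta>0 Cu where U: "\<eta>0 > 0" "Cu \<ge> 1"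
    "\<And>P Y R. 1 \<le> Y \<Longrightarrow> Y \<le> P \<Longrightarrow> 1 \<le> R \<Longrightarrow> R \<le> P powr \<eta>0 \<Longrightarrow>
       U k s Y R \<le> Cu * P powr \<epsilon>1 * Y powr \<sigma>"
    using U_uniform_bound[OF assms \<epsilon>1(1)] unfolding \<sigma>_def by metis
  \<comment> \<open>For q <= Q <= P^(k/2) and N <= P one has q N <= P^(k/2 + 1), so the divisor-type
    bound costs one factor p.\<close>
  define \<delta> where "\<delta> = \<epsilon>1 / (real k / 2 + 1)"
  have \<delta>: "\<delta> > 0" "(real k / 2 + 1) * \<delta> = \<epsilon>1" using \<epsilon>1 by (simp_all add: \<delta>_def)
  obtain Cv where V: "Cv \<ge> 1"
    "\<And>q N. q \<ge> 1 \<Longrightarrow> real (card (prime_supported (prime_factors q) N)) \<le> Cv * (real q * real N) powr \<delta>"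
    using card_prime_supported_prime_factors_le[OF \<delta>(1)] by metis
  \<comment> \<open>The powers of R are R^(2(s - 1)) from Hoelder, R^k from the overlap and R^2 from
    the count of (r, m), together R^(2s + k), which must be at most p.\<close>
  define \<eta> where "\<eta> = min \<eta>0 (\<epsilon>1 / (2 * s + real k))"
  \<comment> \<open>Serves for both 1 + ln P and 1 + log_2 Q, through ln P <= p/\<epsilon>1 and
    log_2 Q <= k ln P/(2 ln 2).\<close>
  define Cl where "Cl = 1 + (1 + real k / (2 * ln 2)) / \<epsilon>1"
  \<comment> \<open>The 18 is 2 times 9, the 9 coming from 1 + 8 R^k <= 9 R^k; the 4 is that of the
    total arc length.\<close>
  define C where "C = 2 powr s * Cv powr s * 4 + 2 powr s * Cv powr (s - 1) * (18 * Cl) * Cu * Cl"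
  have \<eta>: "\<eta> > 0" "\<eta> \<le> \<eta>0" "\<eta> * (2 * s + real k) \<le> \<epsilon>1"
  proof -
    show "\<eta> > 0" using U \<epsilon>1 assms by (simp add: \<eta>_def)
    have "\<eta> \<le> \<epsilon>1 / (2 * s + real k)" by (simp add: \<eta>_def)
    then show "\<eta> * (2 * s + real k) \<le> \<epsilon>1" using assms by (simp add: pos_le_divide_eq)
  qed (simp add: \<eta>_def)
  have bound: "(LINT \<alpha>:major_arcs k Q P|lborel. cmod (weyl_f k \<alpha> P R) powr s)
             \<le> C * P powr (s - real k + \<epsilon>) * Q powr (2 * \<Delta> / real k)"
    if P: "P \<ge> 1" and R: "2 \<le> R" "R \<le> P powr \<eta>" and Q: "1 \<le> Q" "Q \<le> P powr (real k / 2)" for P R Q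
  proof -
    define p where "p = P powr \<epsilon>1"
    define M where "M = P * Q powr (- (2 / real k))"
    define \<rho> where "\<rho> = Q * P powr (- real k)"
    define V where "V = Cv * p"
    define Z where "Z = P powr (s - real k) * Q powr (2 * \<Delta> / real k)"
    note ids = main_term_identity[OF P Q(1) assms(1), folded M_def \<rho>_def]
    have p1: "p \<ge> 1" unfolding p_def using P \<epsilon>1 by (intro ge_one_powr_ge_zero) auto
    have R1: "R \<ge> 1" using R by linarith
    \<comment> \<open>The range Q <= P^(k/2) is exactly what gives M >= 1.\<close>
    have Qk: "Q powr (2 / real k) \<le> P"
    proof -
      have "Q powr (2 / real k) \<le> (P powr (real k / 2)) powr (2 / real k)" using Q by (intro powr_mono2) auto
      also have "\<dots> = P" using P assms by (simp add: powr_powr)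
      finally show ?thesis .
    qed
    have M: "M \<ge> 1" "P \<ge> M"
    proof -
      show "M \<ge> 1" using Qk Q by (simp add: M_def powr_minus field_simps)
      have "Q powr (- (2 / real k)) \<le> 1" using Q by (simp add: powr_le_one_le powr_minus inverse_le_1_iff ge_one_powr_ge_zero)
      then show "P \<ge> M" unfolding M_def using P by (intro mult_left_le) auto
    qed
    have main: "(LINT \<alpha>:major_arcs k Q P|lborel. cmod (weyl_f k \<alpha> P R) powr s)
      \<le> 2 powr s * (M * V) powr s * (4 * Q * \<rho>)
      + 2 powr s * (R * (M * R) * V) powr (s - 1) * (2 * ((1 + log 2 Q) * (1 + 8 * R ^ k)) * (Cu * p) *
          (R * (M * R) * ((P / M) powr \<sigma> / M ^ k) * (1 + ln P)))"
    proof (rule major_arcs_integral_le[OF assms(1,2) \<sigma> M R1 Q(1) \<rho>_def])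
      have "(M * R) ^ k * \<rho> * Q = R ^ k * (M ^ k * \<rho> * Q)" by (simp add: power_mult_distrib)
      then show "(M * R) ^ k * \<rho> * Q \<le> R ^ k" using ids(3) by simp
      show "Cu * p \<ge> 0" using U p1 by simp
      fix q :: nat assume q: "1 \<le> q" "real q \<le> Q"
      have "real q * real (nat \<lfloor>P\<rfloor>) \<le> P powr (real k / 2) * P"
        using q Q P by (intro mult_mono) auto
      also have "\<dots> = P powr (real k / 2 + 1)" using P by (simp add: powr_add)
      finally have "(real q * real (nat \<lfloor>P\<rfloor>)) powr \<delta> \<le> (P powr (real k / 2 + 1)) powr \<delta>"
        using \<delta> by (intro powr_mono2) auto
      also have "\<dots> = p" unfolding powr_powr \<delta>(2) p_def ..
      finally show "real (card (prime_supported (prime_factors q) (nat \<lfloor>P\<rfloor>))) \<le> V"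
        using V(2)[OF q(1), of "nat \<lfloor>P\<rfloor>"] V(1) mult_left_mono[of _ p Cv] unfolding V_def
        by (meson order_trans zero_le_one)
    next
      fix Y r assume "1 \<le> Y" "Y \<le> P" "1 \<le> r" "r \<le> R"
      moreover have "R \<le> P powr \<eta>0" using R \<eta> P by (meson order_trans powr_mono)
      ultimately show "U k s Y r \<le> Cu * p * Y powr \<sigma>" unfolding p_def by (intro U(3)) auto
    qed
    have Z0: "Z \<ge> 0" by (simp add: Z_def)
    have V0: "V \<ge> 0" using V p1 by (simp add: V_def)
    have Rp: "R powr (2 * s + real k) \<le> p"
    proof -
      have "R powr (2 * s + real k) \<le> (P powr \<eta>) powr (2 * s + real k)" using R assms by (intro powr_mono2) auto
      also have "\<dots> \<le> p" unfolding p_def powr_powr using \<eta> P by (intro powr_mono) auto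
      finally show ?thesis .
    qed
    have lnP: "ln P \<le> p / \<epsilon>1" unfolding p_def using P \<epsilon>1 by (intro ln_powr_bound) auto
    have lnP0: "ln P \<ge> 0" using P by simp
    have c0: "real k / (2 * ln 2) / \<epsilon>1 \<ge> 0" "1 / \<epsilon>1 \<ge> 0" using \<epsilon>1 by simp_all
    have log1: "1 + ln P \<le> Cl * p"
    proof -
      have "1 + ln P \<le> p + 1 / \<epsilon>1 * p" using lnP p1 by simp
      also have "\<dots> \<le> p + 1 / \<epsilon>1 * p + real k / (2 * ln 2) / \<epsilon>1 * p" using c0 p1 by simp
      also have "\<dots> = Cl * p" by (simp add: Cl_def ring_distribs add_divide_distrib)
      finally show ?thesis .
    qed
    have log2: "1 + log 2 Q \<le> Cl * p"
    proof -
      have "ln Q \<le> ln (P powr (real k / 2))" using Q P by (intro ln_mono) auto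
      then have "ln Q \<le> real k / 2 * ln P" using P by (simp add: ln_powr)
      then have "log 2 Q \<le> real k / 2 * ln P / ln 2" unfolding log_def by (intro divide_right_mono) auto
      also have "\<dots> = real k / (2 * ln 2) * ln P" by simp
      also have "\<dots> \<le> real k / (2 * ln 2) * (p / \<epsilon>1)" using lnP by (intro mult_left_mono) auto
      finally have "1 + log 2 Q \<le> p + real k / (2 * ln 2) / \<epsilon>1 * p" using p1 by simp
      also have "\<dots> \<le> p + 1 / \<epsilon>1 * p + real k / (2 * ln 2) / \<epsilon>1 * p" using c0 p1 by simp
      also have "\<dots> = Cl * p" by (simp add: Cl_def ring_distribs add_divide_distrib)
      finally show ?thesis .
    qed
    have lQ: "log 2 Q \<ge> 0" using Q by simp
    have Cl0: "Cl \<ge> 0" using \<epsilon>1 by (simp add: Cl_def)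
    have first: "2 powr s * (M * V) powr s * (4 * Q * \<rho>) \<le> 2 powr s * Cv powr s * 4 * (p powr (s + 3) * Z)"
    proof -
      have "2 powr s * (M * V) powr s * (4 * Q * \<rho>) = 2 powr s * Cv powr s * 4 * (p powr s * (M powr s * (Q * \<rho>)))"
        using M V p1 by (simp add: V_def powr_mult)
      also have "M powr s * (Q * \<rho>) = P powr (s - real k) * Q powr (2 - 2 * s / real k)" by (rule ids(2))
      also have "\<dots> \<le> Z"
        unfolding Z_def
      proof (intro mult_left_mono powr_mono)
        \<comment> \<open>The exceptional term is absorbed in the main term because s - k + \<Delta>
          is nonnegative.\<close>
        have "2 * real k - 2 * s \<le> 2 * \<Delta>" using \<sigma> by (simp add: \<sigma>_def)
        then have "(2 * real k - 2 * s) / real k \<le> 2 * \<Delta> / real k" by (intro divide_right_mono) auto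
        then show "2 - 2 * s / real k \<le> 2 * \<Delta> / real k" using assms by (simp add: diff_divide_distrib)
      qed (use Q in auto)
      also have "p powr s \<le> p powr (s + 3)" using p1 by (intro powr_mono) auto
      finally show ?thesis using Z0 V by (simp add: mult_left_mono mult_right_mono mult_nonneg_nonneg)
    qed
    have second: "2 powr s * (R * (M * R) * V) powr (s - 1) * (2 * ((1 + log 2 Q) * (1 + 8 * R ^ k)) * (Cu * p) *
          (R * (M * R) * ((P / M) powr \<sigma> / M ^ k) * (1 + ln P)))
        \<le> 2 powr s * Cv powr (s - 1) * (18 * Cl) * Cu * Cl * (p powr (s + 3) * Z)"
    proof -
      have eq: "R * (M * R) * V = R powr 2 * M * Cv * p" using R1 by (simp add: V_def power2_eq_square mult_ac)
      have a: "(R * (M * R) * V) powr (s - 1) = R powr (2 * (s - 1)) * M powr (s - 1) * Cv powr (s - 1) * p powr (s - 1)"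
        unfolding eq using R1 M V(1) p1 by (simp add: powr_mult powr_powr del: powr_numeral)
      have b: "2 * ((1 + log 2 Q) * (1 + 8 * R ^ k)) \<le> 18 * (Cl * p) * R ^ k"
      proof -
        have "1 + 8 * R ^ k \<le> 9 * R ^ k" using R1 by (simp add: one_le_power)
        then have "(1 + log 2 Q) * (1 + 8 * R ^ k) \<le> (Cl * p) * (9 * R ^ k)"
          using log2 lQ R1 by (intro mult_mono) auto
        then show ?thesis by simp
      qed
      have X0: "(P / M) powr \<sigma> / M ^ k \<ge> 0" using M by simp
      have "2 powr s * (R * (M * R) * V) powr (s - 1) * (2 * ((1 + log 2 Q) * (1 + 8 * R ^ k)) * (Cu * p) *
          (R * (M * R) * ((P / M) powr \<sigma> / M ^ k) * (1 + ln P)))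
        \<le> 2 powr s * (R * (M * R) * V) powr (s - 1) * (18 * (Cl * p) * R ^ k * (Cu * p) *
          (R * (M * R) * ((P / M) powr \<sigma> / M ^ k) * (Cl * p)))"
      proof -
        have Y0: "R * (M * R) * ((P / M) powr \<sigma> / M ^ k) \<ge> 0" using X0 R1 M by (intro mult_nonneg_nonneg) auto
        have "2 * ((1 + log 2 Q) * (1 + 8 * R ^ k)) * (Cu * p) \<le> 18 * (Cl * p) * R ^ k * (Cu * p)"
          using b U(2) p1 by (intro mult_right_mono) auto
        moreover have "R * (M * R) * ((P / M) powr \<sigma> / M ^ k) * (1 + ln P)
            \<le> R * (M * R) * ((P / M) powr \<sigma> / M ^ k) * (Cl * p)"
          using log1 Y0 by (rule mult_left_mono)
        moreover have "0 \<le> 18 * (Cl * p) * R ^ k * (Cu * p)"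
          using U(2) p1 Cl0 R1 by (intro mult_nonneg_nonneg) auto
        moreover have "0 \<le> R * (M * R) * ((P / M) powr \<sigma> / M ^ k) * (1 + ln P)"
          using Y0 lnP0 by (intro mult_nonneg_nonneg[OF Y0]) auto
        ultimately show ?thesis by (intro mult_left_mono[OF mult_mono]) simp_all
      qed
      also have "\<dots> = 2 powr s * Cv powr (s - 1) * (18 * Cl) * Cu * Cl *
          ((R powr (2 * (s - 1)) * R ^ k * R * R) * (p powr (s - 1) * p * p * p) * (M powr (s - 1) * M * ((P / M) powr \<sigma> / M ^ k)))"
        unfolding a by (simp add: mult_ac)
      also have "R powr (2 * (s - 1)) * R ^ k * R * R = R powr (2 * s + real k)"
      proof -
        have "R powr (2 * (s - 1)) * R powr real k * R powr 1 * R powr 1 = R powr (2 * s + real k)"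
          unfolding powr_add[symmetric] by (rule arg_cong[of _ _ "(powr) R"]) simp
        then show ?thesis using R1 by (simp add: powr_realpow)
      qed
      also have "p powr (s - 1) * p * p * p = p powr (s + 2)"
      proof -
        have "p powr (s - 1) * p powr 1 * p powr 1 * p powr 1 = p powr (s + 2)"
          unfolding powr_add[symmetric] by (rule arg_cong[of _ _ "(powr) p"]) simp
        then show ?thesis using p1 by simp
      qed
      also have "M powr (s - 1) * M = M powr s" using M by (simp add: powr_diff)
      also have "M powr s * ((P / M) powr \<sigma> / M ^ k) = Z" unfolding \<sigma>_def Z_def by (rule ids(1))
      also have "2 powr s * Cv powr (s - 1) * (18 * Cl) * Cu * Cl * (R powr (2 * s + real k) * p powr (s + 2) * Z)
        \<le> 2 powr s * Cv powr (s - 1) * (18 * Cl) * Cu * Cl * (p * p powr (s + 2) * Z)"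
        using Rp Z0 Cl0 U(2) by (intro mult_left_mono mult_right_mono) auto
      also have "p * p powr (s + 2) = p powr 1 * p powr (s + 2)" using p1 by simp
      also have "\<dots> = p powr (s + 3)" unfolding powr_add[symmetric] by (simp add: add.commute)
      finally show ?thesis .
    qed
    have "p powr (s + 3) * Z = P powr (s - real k + \<epsilon>) * Q powr (2 * \<Delta> / real k)"
      unfolding p_def Z_def powr_powr \<epsilon>1(2) by (simp add: powr_add mult_ac)
    then have "C * P powr (s - real k + \<epsilon>) * Q powr (2 * \<Delta> / real k) = C * (p powr (s + 3) * Z)"
      by simp
    then show ?thesis using main first second by (simp only: C_def distrib_right)
  qed
  \<comment> \<open>The bound holds for all P >= 1, so 1 serves as the threshold.\<close>
  show "\<exists>\<eta>>0. \<exists>C. \<exists>P0. \<forall>P\<ge>P0. \<forall>R Q.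
           2 \<le> R \<and> R \<le> P powr \<eta> \<and> 1 \<le> Q \<and> Q \<le> P powr (real k / 2) \<longrightarrow>
           (LINT \<alpha>:major_arcs k Q P|lborel. cmod (weyl_f k \<alpha> P R) powr s)
             \<le> C * P powr (s - real k + \<epsilon>) * Q powr (2 * \<Delta> / real k)"
    using \<eta>(1) bound by blast
qed

end
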